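(* Let $F(y)\in\mathbb{K}[y]$ be monic irreducible of degree $s$ with $F(y)\ne y$, let $m$ be the number of irreducible factors of $F(x^n)$ in $R$ and $\ell=n/m$. If $a(x)=a_0+a_1x+\dots+a_{sk\ell}x^{sk\ell}\in R/RF(x^n)$ is nonzero of degree at most $sk\ell$, with $k\le m$, then the rank of $a(x)$ is at least $m-k$. Furthermore, if the rank of $a(x)$ equals $m-k$, then $\deg a(x)=sk\ell$ and $$\frac{\mathrm{N}_{\mathbb{L}/\mathbb{K}}(a_0)}{\mathrm{N}_{\mathbb{L}/\mathbb{K}}(a_{sk\ell})}=(-1)^{sk\ell(n-1)}F_0^{k\ell},$$ where $F_0$ is the constant coefficient of $F(x^n)$.
   Context: Let $\mathbb{K}$ be a field, $\mathbb{L}/\mathbb{K}$ a cyclic Galois extension of degree $n\ge2$, $\sigma$ a generator of $\mathrm{Gal}(\mathbb{L}/\mathbb{K})$, and $R=\mathbb{L}[x;\sigma]$ the skew polynomial ring with $xa=\sigma(a)x$ ($a\in\mathbb{L}$), centre $\mathbb{K}[x^n]$. For $F$ as in the claim, $F(x^n)$ factors in $R$ as a product of $m$ irreducibles, $m\mid n$, each of degree $s\ell$; for an irreducible divisor $f$ of $F(x^n)$, the eigenring $\mathcal{E}(f)=\{g\in R:\deg g<\deg f,\ fg\in Rf\}$ (multiplication modulo $Rf$) is a division algebra, $R/Rf$ is a right $\mathcal{E}(f)$-vector space of dimension $m$, and $R/RF(x^n)\cong \mathrm{End}_{\mathcal{E}(f)}(R/Rf)\cong M_m(\mathcal{E}(f))$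 via $a\mapsto(b\mapsto ab\bmod_r f)$. The rank of $a\in R/RF(x^n)$ is the rank of the corresponding matrix in $M_m(\mathcal{E}(f))$; equivalently $\mathrm{rk}(a)=m-\frac{1}{s\ell}\deg(\mathrm{gcrd}(a,F(x^n)))$. Elements of $R/RF(x^n)$ are represented by polynomials of degree $<sn$. *)

theory Defs
  imports Complex_Main "HOL-Algebra.Generated_Groups" "HOL-Computational_Algebra.Polynomial"
begin

section \<open>Cyclic Galois extensions\<close>

text \<open>An extension L/K is given by an embedding \<open>\<iota>\<close> of the field \<open>'k\<close> into the field \<open>'l\<close>.\<close>

definition ring_homomorphism :: "('a::ring_1 \<Rightarrow> 'b::ring_1) \<Rightarrow> bool" where
  "ring_homomorphism h \<longleftrightarrow>
     h 1 = 1 \<and> (\<forall>x y. h (x + y) = h x + h y) \<and> (\<forall>x y. h (x * y) = h x * h y)"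

definition galois_group :: "('k::field \<Rightarrow> 'l::field) \<Rightarrow> ('l \<Rightarrow> 'l) monoid" where
  "galois_group \<iota> =
     \<lparr>carrier = {\<tau>. bij \<tau> \<and> ring_homomorphism \<tau> \<and> (\<forall>c. \<tau> (\<iota> c) = \<iota> c)},
      monoid.mult = (\<circ>), one = id\<rparr>"

definition extension_degree :: "('k::field \<Rightarrow> 'l::field) \<Rightarrow> nat" where
  "extension_degree \<iota> = vector_space.dim (\<lambda>c x. \<iota> c * x) (UNIV :: 'l set)"

text \<open>\<open>vector_space.dim\<close> is 0 for infinite-dimensional spaces, so \<open>n > 0\<close> makes the
  extension finite; for finite extensions, being Galois means that the fixed field of the
  automorphism group is K.\<close>

definition cyclic_galois_extension ::
    "('k::field \<Rightarrow> 'l::field) \<Rightarrow> nat \<Rightarrow> ('l \<Rightarrow> 'l) \<Rightarrow> bool" where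
  "cyclic_galois_extension \<iota> n \<sigma> \<longleftrightarrow>
     ring_homomorphism \<iota> \<and> 0 < n \<and> extension_degree \<iota> = n \<and>
     {x. \<forall>\<tau>\<in>carrier (galois_group \<iota>). \<tau> x = x} = range \<iota> \<and>
     \<sigma> \<in> carrier (galois_group \<iota>) \<and>
     generate (galois_group \<iota>) {\<sigma>} = carrier (galois_group \<iota>)"

definition field_norm :: "('k::field \<Rightarrow> 'l::field) \<Rightarrow> 'l \<Rightarrow> 'l" where
  "field_norm \<iota> x = (\<Prod>\<tau>\<in>carrier (galois_group \<iota>). \<tau> x)"


section \<open>The skew polynomial ring\<close>

text \<open>A skew polynomial is represented by the \<open>poly\<close> of its left coefficients
  (\<open>a\<^sub>0 + a\<^sub>1 x + a\<^sub>2 x\<^sup>2 + \<dots>\<close>); only the multiplication differs from that of \<open>poly\<close>: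
  \<open>(a x\<^sup>i) (b x\<^sup>j) = a \<sigma>\<^sup>i(b) x\<^sup>i\<^sup>+\<^sup>j\<close>.\<close>

definition skew_mult :: "('l::field \<Rightarrow> 'l) \<Rightarrow> 'l poly \<Rightarrow> 'l poly \<Rightarrow> 'l poly" where
  "skew_mult \<sigma> p q =
     (\<Sum>i\<le>degree p. \<Sum>j\<le>degree q. monom (coeff p i * (\<sigma> ^^ i) (coeff q j)) (i + j))"

definition skew_unit :: "('l::field \<Rightarrow> 'l) \<Rightarrow> 'l poly \<Rightarrow> bool" where
  "skew_unit \<sigma> u \<longleftrightarrow> (\<exists>v. skew_mult \<sigma> u v = 1 \<and> skew_mult \<sigma> v u = 1)"

definition skew_irreducible :: "('l::field \<Rightarrow> 'l) \<Rightarrow> 'l poly \<Rightarrow> bool" where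
  "skew_irreducible \<sigma> f \<longleftrightarrow> f \<noteq> 0 \<and> \<not> skew_unit \<sigma> f \<and>
     (\<forall>g h. f = skew_mult \<sigma> g h \<longrightarrow> skew_unit \<sigma> g \<or> skew_unit \<sigma> h)"

definition skew_right_dvd :: "('l::field \<Rightarrow> 'l) \<Rightarrow> 'l poly \<Rightarrow> 'l poly \<Rightarrow> bool" where
  "skew_right_dvd \<sigma> f p \<longleftrightarrow> (\<exists>q. p = skew_mult \<sigma> q f)"

definition skew_prod_list :: "('l::field \<Rightarrow> 'l) \<Rightarrow> 'l poly list \<Rightarrow> 'l poly" where
  "skew_prod_list \<sigma> fs = foldr (skew_mult \<sigma>) fs 1"

definition has_irreducible_factors :: "('l::field \<Rightarrow> 'l) \<Rightarrow> 'l poly \<Rightarrow> nat \<Rightarrow> bool" where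
  "has_irreducible_factors \<sigma> p m \<longleftrightarrow>
     (\<exists>fs. length fs = m \<and> (\<forall>f\<in>set fs. skew_irreducible \<sigma> f) \<and> skew_prod_list \<sigma> fs = p)"

text \<open>The element \<open>F(x\<^sup>n)\<close> of the skew polynomial ring.\<close>

definition at_x_power :: "('k::field \<Rightarrow> 'l::field) \<Rightarrow> nat \<Rightarrow> 'k poly \<Rightarrow> 'l poly" where
  "at_x_power \<iota> n F = (\<Sum>i\<le>degree F. monom (\<iota> (coeff F i)) (n * i))"


section \<open>The eigenring and the rank\<close>

text \<open>Remainder of the right division of \<open>g\<close> by a nonconstant \<open>f\<close>. As \<open>degree 0 = 0\<close>, the
  conditions \<open>degree r < degree f\<close> below are meaningful only for \<open>degree f > 0\<close>, which holds
  for irreducible \<open>f\<close>.\<close>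

definition skew_mod :: "('l::field \<Rightarrow> 'l) \<Rightarrow> 'l poly \<Rightarrow> 'l poly \<Rightarrow> 'l poly" where
  "skew_mod \<sigma> f g = (THE r. degree r < degree f \<and> (\<exists>q. g = skew_mult \<sigma> q f + r))"

definition residues_mod :: "'l::field poly \<Rightarrow> 'l poly set" where
  "residues_mod f = {b. degree b < degree f}"

definition mult_mod :: "('l::field \<Rightarrow> 'l) \<Rightarrow> 'l poly \<Rightarrow> 'l poly \<Rightarrow> 'l poly \<Rightarrow> 'l poly" where
  "mult_mod \<sigma> f g h = skew_mod \<sigma> f (skew_mult \<sigma> g h)"

definition eigenring :: "('l::field \<Rightarrow> 'l) \<Rightarrow> 'l poly \<Rightarrow> 'l poly set" where
  "eigenring \<sigma> f = {g. degree g < degree f \<and> skew_right_dvd \<sigma> f (skew_mult \<sigma> f g)}"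

text \<open>The module \<open>R/Rf\<close> is represented by \<open>residues_mod f\<close>. Multiplication in the eigenring,
  its right action on \<open>R/Rf\<close> and the left action of \<open>R\<close> on \<open>R/Rf\<close> are all given by
  \<open>mult_mod \<sigma> f\<close>.\<close>

definition right_lincomb ::
    "('l::field \<Rightarrow> 'l) \<Rightarrow> 'l poly \<Rightarrow> 'l poly list \<Rightarrow> (nat \<Rightarrow> 'l poly) \<Rightarrow> 'l poly" where
  "right_lincomb \<sigma> f bs c = (\<Sum>i<length bs. mult_mod \<sigma> f (bs ! i) (c i))"

definition eigenring_basis :: "('l::field \<Rightarrow> 'l) \<Rightarrow> 'l poly \<Rightarrow> 'l poly list \<Rightarrow> bool" where
  "eigenring_basis \<sigma> f bs \<longleftrightarrow>
     set bs \<subseteq> residues_mod f \<and>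
     (\<forall>c. (\<forall>i<length bs. c i \<in> eigenring \<sigma> f) \<and> right_lincomb \<sigma> f bs c = 0
        \<longrightarrow> (\<forall>i<length bs. c i = 0)) \<and>
     (\<forall>v\<in>residues_mod f. \<exists>c. (\<forall>i<length bs. c i \<in> eigenring \<sigma> f) \<and>
        right_lincomb \<sigma> f bs c = v)"

text \<open>\<open>M\<close> is the matrix over the eigenring, with respect to the basis \<open>bs\<close>, of the
  endomorphism \<open>b \<mapsto> a b\<close> of \<open>R/Rf\<close>; entry \<open>M i j\<close> is in row \<open>i\<close> and column \<open>j\<close>.\<close>

definition matrix_of ::
    "('l::field \<Rightarrow> 'l) \<Rightarrow> 'l poly \<Rightarrow> 'l poly list \<Rightarrow> 'l poly \<Rightarrow> (nat \<Rightarrow> nat \<Rightarrow> 'l poly) \<Rightarrow> bool" where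
  "matrix_of \<sigma> f bs a M \<longleftrightarrow>
     (\<forall>i<length bs. \<forall>j<length bs. M i j \<in> eigenring \<sigma> f) \<and>
     (\<forall>j<length bs. mult_mod \<sigma> f a (bs ! j) = right_lincomb \<sigma> f bs (\<lambda>i. M i j))"

text \<open>Over a noncommutative division ring, the rank of a \<open>d \<times> d\<close> matrix is the maximal number
  of right linearly independent columns.\<close>

definition columns_independent ::
    "('l::field \<Rightarrow> 'l) \<Rightarrow> 'l poly \<Rightarrow> nat \<Rightarrow> (nat \<Rightarrow> nat \<Rightarrow> 'l poly) \<Rightarrow> nat set \<Rightarrow> bool" where
  "columns_independent \<sigma> f d M J \<longleftrightarrow>
     (\<forall>c. (\<forall>j\<in>J. c j \<in> eigenring \<sigma> f) \<and> (\<forall>i<d. (\<Sum>j\<in>J. mult_mod \<sigma> f (M i j) (c j)) = 0)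
        \<longrightarrow> (\<forall>j\<in>J. c j = 0))"

definition matrix_rank ::
    "('l::field \<Rightarrow> 'l) \<Rightarrow> 'l poly \<Rightarrow> nat \<Rightarrow> (nat \<Rightarrow> nat \<Rightarrow> 'l poly) \<Rightarrow> nat" where
  "matrix_rank \<sigma> f d M = Max {card J | J. J \<subseteq> {..<d} \<and> columns_independent \<sigma> f d M J}"

text \<open>The rank does not depend on the chosen basis, and the matrix is determined by the basis.\<close>

definition skew_rank :: "('l::field \<Rightarrow> 'l) \<Rightarrow> 'l poly \<Rightarrow> 'l poly \<Rightarrow> nat" where
  "skew_rank \<sigma> f a =
     (let bs = (SOME bs. eigenring_basis \<sigma> f bs)
      in matrix_rank \<sigma> f (length bs) (SOME M. matrix_of \<sigma> f bs a M))"

end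

theory Submission
  imports Defs "Jordan_Normal_Form.Determinant"
begin

text \<open>Let \<open>V = R/Rf\<close>. If \<open>t\<close> elements of \<open>V\<close> are independent over the eigenring, then by Jacobson
  density their annihilator in \<open>R\<close> is generated by a skew polynomial of degree \<open>t deg f\<close>.
  The annihilator of \<open>V\<close> itself is two-sided, hence generated by \<open>F(x\<^sup>n)\<close>, which gives
  \<open>deg f = s l\<close>. If \<open>a\<close> has rank \<open>r\<close>, the annihilator of \<open>a V\<close> has a generator \<open>g\<close> of degree
  \<open>r s l\<close>, and \<open>g a\<close> annihilates \<open>V\<close>; so \<open>r s l + deg a \<ge> m s l\<close>, and in the case of equality \<open>a\<close>
  is a right divisor of \<open>F(x\<^sup>n)\<close>. The reduced norm of a right divisor of \<open>F(x\<^sup>n)\<close> lies in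
  \<open>K[x\<^sup>n]\<close> and divides \<open>F(x\<^sup>n)\<^sup>n\<close>, so it is a constant times a power of \<open>F(x\<^sup>n)\<close>; its constant
  and leading coefficients are \<open>N(a\<^sub>0)\<close> and, up to sign, the norm of the leading coefficient
  of \<open>a\<close>.\<close>

section \<open>Skew polynomial rings\<close>

text \<open>\<open>skew_rank\<close> rests on a chosen basis of R/Rf and a chosen matrix. Everything
  is therefore phrased by divisibility in R, where the choice disappears: only the maximality of an
  independent set of columns enters. The number m is not identified with the dimension of R/Rf; it
  enters through a count of degrees, m deg f = n s. Since l is the truncated quotient
  \<open>n div m\<close>, it must also be shown that m divides n: the reduced norm of f itself gives
  that s divides deg f, and then deg f = s l. The hypothesis F \<noteq> y makes the constant
  coefficient of F nonzero, which forces a two-sided generator dividing F(x^n) into the centre, up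
  to a constant factor. The sign in the theorem is that of the n-cycle: x acts as a cyclic shift,
  and its reduced norm is (-1)^(n-1) x^n.\<close>

locale skew_ring =
  fixes \<sigma> :: "'l::field \<Rightarrow> 'l"
  assumes ring_hom: "ring_homomorphism \<sigma>"
begin

abbreviation smul :: "'l poly \<Rightarrow> 'l poly \<Rightarrow> 'l poly"  (infixl "\<odot>" 70) where
  "p \<odot> q \<equiv> skew_mult \<sigma> p q"

abbreviation rdvd :: "'l poly \<Rightarrow> 'l poly \<Rightarrow> bool"  (infix "rdvd" 50) where
  "f rdvd p \<equiv> skew_right_dvd \<sigma> f p"

lemma pow_add: "(\<sigma> ^^ i) (x + y) = (\<sigma> ^^ i) x + (\<sigma> ^^ i) y"
  using ring_hom by (induction i) (auto simp: ring_homomorphism_def)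

lemma pow_mult: "(\<sigma> ^^ i) (x * y) = (\<sigma> ^^ i) x * (\<sigma> ^^ i) y"
  using ring_hom by (induction i) (auto simp: ring_homomorphism_def)

lemma pow_1 [simp]: "(\<sigma> ^^ i) 1 = 1"
  using ring_hom by (induction i) (auto simp: ring_homomorphism_def)

lemma pow_0 [simp]: "(\<sigma> ^^ i) 0 = 0"
proof -
  have "(\<sigma> ^^ i) 0 + (\<sigma> ^^ i) 0 = (\<sigma> ^^ i) 0 + 0"
    using pow_add[of i 0 0] by simp
  then show ?thesis by (simp only: add_left_cancel)
qed

lemma pow_minus: "(\<sigma> ^^ i) (- x) = - (\<sigma> ^^ i) x"
  using pow_add[of i x "- x"] by (simp add: add_eq_0_iff)

lemma pow_sum: "(\<sigma> ^^ i) (sum g A) = (\<Sum>a\<in>A. (\<sigma> ^^ i) (g a))"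
  by (induction A rule: infinite_finite_induct) (simp_all add: pow_add)

lemma pow_eq_0_iff [simp]: "(\<sigma> ^^ i) x = 0 \<longleftrightarrow> x = 0"
proof
  assume *: "(\<sigma> ^^ i) x = 0"
  show "x = 0"
  proof (rule ccontr)
    assume "x \<noteq> 0"
    then have "(\<sigma> ^^ i) (x * inverse x) = 1" by simp
    with * show False by (simp add: pow_mult)
  qed
qed simp

lemma \<sigma>_simps [simp]: "\<sigma> 0 = 0" "\<sigma> 1 = 1" "\<sigma> x = 0 \<longleftrightarrow> x = 0"
  using pow_0[of 1] pow_1[of 1] pow_eq_0_iff[of 1] by simp_all

lemma inj_pow: "inj (\<sigma> ^^ i)"
proof (rule injI)
  fix x y assume "(\<sigma> ^^ i) x = (\<sigma> ^^ i) y"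
  then have "(\<sigma> ^^ i) (x + - y) = 0" by (simp only: pow_add pow_minus) simp
  then show "x = y" by simp
qed

lemma coeff_skew_mult:
  "coeff (p \<odot> q) k = (\<Sum>i\<le>k. coeff p i * (\<sigma> ^^ i) (coeff q (k - i)))"
proof -
  have inner: "(\<Sum>j\<le>degree q. coeff (monom (coeff p i * (\<sigma> ^^ i) (coeff q j)) (i + j)) k)
      = (if i \<le> k then coeff p i * (\<sigma> ^^ i) (coeff q (k - i)) else 0)" for i
  proof (cases "i \<le> k \<and> k - i \<le> degree q")
    case True
    have "(\<Sum>j\<le>degree q. coeff (monom (coeff p i * (\<sigma> ^^ i) (coeff q j)) (i + j)) k)
      = (\<Sum>j\<in>{k - i}. coeff (monom (coeff p i * (\<sigma> ^^ i) (coeff q j)) (i + j)) k)"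
      by (rule sum.mono_neutral_right) (use True in auto)
    then show ?thesis using True by simp
  next
    case False
    then have "(\<Sum>j\<le>degree q. coeff (monom (coeff p i * (\<sigma> ^^ i) (coeff q j)) (i + j)) k) = 0"
      by (intro sum.neutral) auto
    moreover have "i \<le> k \<Longrightarrow> coeff q (k - i) = 0" using False by (intro coeff_eq_0) auto
    ultimately show ?thesis by auto
  qed
  have "coeff (p \<odot> q) k
      = (\<Sum>i\<le>degree p. if i \<le> k then coeff p i * (\<sigma> ^^ i) (coeff q (k - i)) else 0)"
    unfolding skew_mult_def coeff_sum inner ..
  also have "\<dots> = (\<Sum>i\<in>{..degree p} \<inter> {..k}. coeff p i * (\<sigma> ^^ i) (coeff q (k - i)))"
    by (simp add: sum.inter_restrict del: Int_atMost)
  also have "\<dots> = (\<Sum>i\<le>k. coeff p i * (\<sigma> ^^ i) (coeff q (k - i)))"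
    by (rule sum.mono_neutral_left) (auto simp: coeff_eq_0)
  finally show ?thesis .
qed

lemma skew_mult_0 [simp]: "0 \<odot> q = 0" "p \<odot> 0 = 0"
  by (auto simp: poly_eq_iff coeff_skew_mult)

lemma add_skew_mult: "(p + p') \<odot> q = p \<odot> q + p' \<odot> q"
  by (simp add: poly_eq_iff coeff_skew_mult algebra_simps sum.distrib)

lemma skew_mult_add: "p \<odot> (q + q') = p \<odot> q + p \<odot> q'"
  by (simp add: poly_eq_iff coeff_skew_mult algebra_simps sum.distrib pow_add)

lemma minus_skew_mult: "(- p) \<odot> q = - (p \<odot> q)"
  using add_skew_mult[of p "- p" q] by (simp add: add_eq_0_iff)

lemma skew_mult_minus: "p \<odot> (- q) = - (p \<odot> q)"
  using skew_mult_add[of p q "- q"] by (simp add: add_eq_0_iff)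

lemma diff_skew_mult: "(p - p') \<odot> q = p \<odot> q - p' \<odot> q"
  using add_skew_mult[of p "- p'" q] by (simp add: minus_skew_mult)

lemma skew_mult_diff: "p \<odot> (q - q') = p \<odot> q - p \<odot> q'"
  using skew_mult_add[of p q "- q'"] by (simp add: skew_mult_minus)

lemmas skew_distribs = add_skew_mult skew_mult_add diff_skew_mult skew_mult_diff
  minus_skew_mult skew_mult_minus

lemma sum_skew_mult: "sum g A \<odot> q = (\<Sum>a\<in>A. g a \<odot> q)"
  by (induction A rule: infinite_finite_induct) (simp_all add: add_skew_mult)

lemma skew_mult_sum: "p \<odot> sum g A = (\<Sum>a\<in>A. p \<odot> g a)"
  by (induction A rule: infinite_finite_induct) (simp_all add: skew_mult_add)

lemma monom_skew_monom: "monom a i \<odot> monom b j = monom (a * (\<sigma> ^^ i) b) (i + j)"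
proof (rule poly_eqI)
  fix k
  have "coeff (monom a i \<odot> monom b j) k
      = (\<Sum>i'\<in>{..k} \<inter> {i}. coeff (monom a i) i' * (\<sigma> ^^ i') (coeff (monom b j) (k - i')))"
    unfolding coeff_skew_mult by (rule sum.mono_neutral_right) auto
  then show "coeff (monom a i \<odot> monom b j) k = coeff (monom (a * (\<sigma> ^^ i) b) (i + j)) k"
    by (cases "i \<le> k") auto
qed

lemma skew_mult_const: "[:a:] \<odot> p = Polynomial.smult a p"
  by (simp add: poly_eq_iff coeff_skew_mult sum.atMost_shift)

lemma skew_mult_1 [simp]: "1 \<odot> p = p" "p \<odot> 1 = p"
proof -
  show "1 \<odot> p = p" using skew_mult_const[of 1 p] by (simp add: one_pCons)
  have "(\<Sum>i\<le>degree p. monom (coeff p i) i) \<odot> monom 1 0 = p"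
    by (simp only: sum_skew_mult monom_skew_monom) (simp add: poly_as_sum_of_monoms)
  then show "p \<odot> 1 = p"
    by (simp add: poly_as_sum_of_monoms)
qed

lemma skew_mult_assoc: "p \<odot> q \<odot> r = p \<odot> (q \<odot> r)"
proof -
  have 1: "monom a i \<odot> monom b j \<odot> monom c k = monom a i \<odot> (monom b j \<odot> monom c k)"
    for a b c i j k
    by (simp add: monom_skew_monom pow_mult funpow_add add.assoc mult.assoc)
  have 2: "monom a i \<odot> monom b j \<odot> r = monom a i \<odot> (monom b j \<odot> r)" for a b i j r
    by (subst (1 2) poly_as_sum_of_monoms[of r, symmetric]) (simp only: skew_mult_sum 1)
  have 3: "monom a i \<odot> q \<odot> r = monom a i \<odot> (q \<odot> r)" for a i
    by (subst (1 2) poly_as_sum_of_monoms[of q, symmetric])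
       (simp only: skew_mult_sum sum_skew_mult 2)
  show ?thesis
    by (subst (1 2) poly_as_sum_of_monoms[of p, symmetric]) (simp only: sum_skew_mult 3)
qed

lemma coeff_skew_mult_degree_sum:
  "coeff (p \<odot> q) (degree p + degree q) = lead_coeff p * (\<sigma> ^^ degree p) (lead_coeff q)"
proof -
  have "coeff (p \<odot> q) (degree p + degree q)
      = (\<Sum>i\<in>{degree p}. coeff p i * (\<sigma> ^^ i) (coeff q (degree p + degree q - i)))"
    unfolding coeff_skew_mult
  proof (rule sum.mono_neutral_right)
    show "\<forall>i\<in>{..degree p + degree q} - {degree p}.
        coeff p i * (\<sigma> ^^ i) (coeff q (degree p + degree q - i)) = 0"
    proof
      fix i assume "i \<in> {..degree p + degree q} - {degree p}"
      then have "i > degree p \<or> degree p + degree q - i > degree q" by auto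
      then show "coeff p i * (\<sigma> ^^ i) (coeff q (degree p + degree q - i)) = 0"
        by (auto simp: coeff_eq_0)
    qed
  qed auto
  then show ?thesis by simp
qed

lemma degree_skew_mult_le: "degree (p \<odot> q) \<le> degree p + degree q"
proof (rule degree_le, intro allI impI)
  fix k assume k: "degree p + degree q < k"
  show "coeff (p \<odot> q) k = 0"
    unfolding coeff_skew_mult
  proof (rule sum.neutral, rule ballI)
    fix i assume "i \<in> {..k}"
    then have "i > degree p \<or> k - i > degree q" using k by auto
    then show "coeff p i * (\<sigma> ^^ i) (coeff q (k - i)) = 0" by (auto simp: coeff_eq_0)
  qed
qed

lemma degree_skew_mult: "p \<noteq> 0 \<Longrightarrow> q \<noteq> 0 \<Longrightarrow> degree (p \<odot> q) = degree p + degree q"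
  by (rule antisym[OF degree_skew_mult_le le_degree]) (simp add: coeff_skew_mult_degree_sum)

lemma skew_mult_eq_0_iff [simp]: "p \<odot> q = 0 \<longleftrightarrow> p = 0 \<or> q = 0"
proof
  assume *: "p \<odot> q = 0"
  show "p = 0 \<or> q = 0"
  proof (rule ccontr)
    assume "\<not> (p = 0 \<or> q = 0)"
    then have "coeff (p \<odot> q) (degree p + degree q) \<noteq> 0"
      by (simp add: coeff_skew_mult_degree_sum)
    with * show False by simp
  qed
qed auto

lemma skew_mult_right_cancel: "p \<odot> g = q \<odot> g \<Longrightarrow> g \<noteq> 0 \<Longrightarrow> p = q"
  using skew_mult_eq_0_iff[of "p - q" g] by (simp add: diff_skew_mult)

section \<open>Right division, the Ore condition and remainders\<close>

lemma skew_division: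
  assumes "f \<noteq> 0"
  shows "\<exists>q r. g = q \<odot> f + r \<and> (r = 0 \<or> degree r < degree f)"
proof (induction "degree g" arbitrary: g rule: less_induct)
  case less
  show ?case
  proof (cases "g = 0 \<or> degree g < degree f")
    case True
    then show ?thesis by (intro exI[of _ 0] exI[of _ g]) auto
  next
    case False
    define e where "e = degree g - degree f"
    \<comment> \<open>In \<open>t \<odot> f\<close> the leading coefficient of \<open>f\<close>
      appears twisted by \<open>\<sigma> ^^ e\<close>, so the quotient is taken by its image, which
      is nonzero by injectivity.\<close>
    define t where "t = monom (lead_coeff g / (\<sigma> ^^ e) (lead_coeff f)) e"
    have t0: "t \<noteq> 0" and dt: "degree t = e" using False assms
      by (auto simp: t_def degree_monom_eq)
    have deg: "degree (t \<odot> f) = degree g"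
      using False by (simp add: degree_skew_mult t0 assms dt e_def)
    have "coeff (t \<odot> f) (degree g) = lead_coeff g"
      using coeff_skew_mult_degree_sum[of t f] False assms
      by (simp add: dt) (simp add: e_def t_def)
    then have "coeff (g - t \<odot> f) (degree g) = 0" by simp
    moreover have "degree (g - t \<odot> f) \<le> degree g" using deg by (simp add: degree_diff_le)
    ultimately have "g - t \<odot> f = 0 \<or> degree (g - t \<odot> f) < degree g"
      by (metis le_neq_implies_less leading_coeff_0_iff)
    then show ?thesis
    proof
      assume "g - t \<odot> f = 0"
      then show ?thesis by (intro exI[of _ t] exI[of _ 0]) simp
    next
      assume "degree (g - t \<odot> f) < degree g"
      from less[OF this] obtain q r
        where "g - t \<odot> f = q \<odot> f + r" "r = 0 \<or> degree r < degree f" by blast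
      then show ?thesis
        by (intro exI[of _ "t + q"] exI[of _ r]) (simp add: skew_distribs algebra_simps)
    qed
  qed
qed

lemma rdvd_self [simp]: "f rdvd f" "f rdvd q \<odot> f" "f rdvd 0"
  unfolding skew_right_dvd_def by (metis skew_mult_1(1), blast, metis skew_mult_0(1))

lemma rdvd_add: "f rdvd p \<Longrightarrow> f rdvd q \<Longrightarrow> f rdvd p + q"
  unfolding skew_right_dvd_def by (metis add_skew_mult)

lemma rdvd_diff: "f rdvd p \<Longrightarrow> f rdvd q \<Longrightarrow> f rdvd p - q"
  unfolding skew_right_dvd_def by (metis diff_skew_mult)

lemma rdvd_minus: "f rdvd - p \<longleftrightarrow> f rdvd p"
  using rdvd_diff[of f 0] rdvd_self(3) by fastforce

lemma rdvd_mult: "f rdvd p \<Longrightarrow> f rdvd q \<odot> p"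
  unfolding skew_right_dvd_def by (metis skew_mult_assoc)

lemma rdvd_sum: "(\<And>i. i \<in> A \<Longrightarrow> f rdvd g i) \<Longrightarrow> f rdvd sum g A"
  by (induction A rule: infinite_finite_induct) (auto intro: rdvd_add)

lemma rdvd_diff_iff: "f rdvd p - q \<Longrightarrow> f rdvd p \<longleftrightarrow> f rdvd q"
  using rdvd_add[of f "p - q" q] rdvd_diff[of f p "p - q"] by auto

lemma rdvd_degree: "f rdvd p \<Longrightarrow> p \<noteq> 0 \<Longrightarrow> degree f \<le> degree p"
  unfolding skew_right_dvd_def by (auto simp: degree_skew_mult)

lemma skew_unit_iff: "skew_unit \<sigma> u \<longleftrightarrow> u \<noteq> 0 \<and> degree u = 0"
proof
  assume "skew_unit \<sigma> u"
  then obtain v where v: "u \<odot> v = 1" unfolding skew_unit_def by blast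
  then have "u \<noteq> 0" "v \<noteq> 0" by auto
  with degree_skew_mult[of u v] v show "u \<noteq> 0 \<and> degree u = 0" by simp
next
  assume "u \<noteq> 0 \<and> degree u = 0"
  then obtain c where c: "u = [:c:]" "c \<noteq> 0" by (metis degree_eq_zeroE pCons_0_0)
  then show "skew_unit \<sigma> u"
    unfolding skew_unit_def by (intro exI[of _ "[:inverse c:]"]) (simp add: skew_mult_const one_pCons)
qed

lemma skew_irreducible_degree: "skew_irreducible \<sigma> f \<Longrightarrow> f \<noteq> 0 \<and> 0 < degree f"
  unfolding skew_irreducible_def skew_unit_iff by auto

text \<open>A Euclidean algorithm: with w = q f + r, the induction applied to the pair (r, f) gives
  h f = u r, and then u w = (u q + h) f, so u is the multiplier sought. The degree bound is the
  point: it does the work of a dimension count over L.\<close>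

lemma ore_condition:
  assumes "f \<noteq> 0"
  shows "\<exists>h. h \<noteq> 0 \<and> degree h \<le> degree f \<and> f rdvd h \<odot> w"
  using assms
proof (induction "degree f" arbitrary: f w rule: less_induct)
  case less
  from skew_division[OF \<open>f \<noteq> 0\<close>, of w] obtain q r
    where qr: "w = q \<odot> f + r" "r = 0 \<or> degree r < degree f" by blast
  show ?case
  proof (cases "r = 0")
    case True
    then show ?thesis using qr by (intro exI[of _ 1]) simp
  next
    case False
    with qr have "degree r < degree f" by simp
    from less.hyps[OF this False, of f] obtain h u
      where h: "h \<noteq> 0" "degree h \<le> degree r" and u: "h \<odot> f = u \<odot> r"
      unfolding skew_right_dvd_def by blast
    have "u \<noteq> 0" using u h less.prems by (metis skew_mult_eq_0_iff)
    have "degree h + degree f = degree u + degree r"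
      using u h less.prems False \<open>u \<noteq> 0\<close> by (metis degree_skew_mult)
    with h have "degree u \<le> degree f" by simp
    moreover have "u \<odot> w = (u \<odot> q + h) \<odot> f"
      by (simp add: qr skew_distribs skew_mult_assoc u)
    ultimately show ?thesis using \<open>u \<noteq> 0\<close> unfolding skew_right_dvd_def by blast
  qed
qed

lemma skew_mod_props:
  assumes "0 < degree f"
  shows "degree (skew_mod \<sigma> f g) < degree f" and "f rdvd g - skew_mod \<sigma> f g"
proof -
  have "f \<noteq> 0" using assms by auto
  let ?P = "\<lambda>r. degree r < degree f \<and> (\<exists>q. g = q \<odot> f + r)"
  have "?P (skew_mod \<sigma> f g)"
    unfolding skew_mod_def
  proof (rule theI')
    show "\<exists>!r. ?P r"
    proof (rule ex_ex1I)
      show "\<exists>r. ?P r" using skew_division[OF \<open>f \<noteq> 0\<close>, of g] assms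
        by (metis degree_0)
    next
      fix r r' assume *: "?P r" "?P r'"
      then have "f rdvd (r - r')"
        unfolding skew_right_dvd_def by (metis add_diff_cancel_left add_diff_cancel_left' diff_add_cancel diff_skew_mult)
      moreover have "degree (r - r') < degree f" using * by (meson degree_diff_less)
      ultimately show "r = r'" using rdvd_degree by fastforce
    qed
  qed
  then show "degree (skew_mod \<sigma> f g) < degree f" "f rdvd g - skew_mod \<sigma> f g"
    unfolding skew_right_dvd_def by auto (metis add_diff_cancel_right')
qed


subsection \<open>Density\<close>

lemma left_ideal_generator:
  assumes "p \<in> I" "p \<noteq> 0"
    and diff: "\<And>a b. a \<in> I \<Longrightarrow> b \<in> I \<Longrightarrow> a - b \<in> I"
    and mult: "\<And>a b. b \<in> I \<Longrightarrow> a \<odot> b \<in> I"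
  obtains g where "g \<in> I" "g \<noteq> 0" "\<And>r. r \<in> I \<Longrightarrow> g rdvd r"
proof -
  obtain g where g: "g \<in> I" "g \<noteq> 0" and
    min: "\<And>r. r \<in> I \<Longrightarrow> r \<noteq> 0 \<Longrightarrow> degree g \<le> degree r"
    using ex_has_least_nat[of "\<lambda>g. g \<in> I \<and> g \<noteq> 0" p degree] assms(1,2) by blast
  have "g rdvd r" if "r \<in> I" for r
  proof -
    from skew_division[OF \<open>g \<noteq> 0\<close>, of r] obtain q t
      where qt: "r = q \<odot> g + t" "t = 0 \<or> degree t < degree g" by blast
    have "t = r - q \<odot> g" using qt by simp
    then have "t \<in> I" using diff mult that g by blast
    then have "t = 0" using min[of t] qt by force
    then show ?thesis using qt by simp
  qed
  with g that show thesis by blast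
qed

text \<open>R/Rf is simple: the left ideal R w + R f has a generator \<open>g\<close>, and f = t g.
  If t were a unit, f would right divide g and hence w; so g is a unit by irreducibility, and 1 lies
  in the ideal.\<close>

lemma irreducible_left_inverse:
  assumes irr: "skew_irreducible \<sigma> f" and w: "\<not> f rdvd w"
  obtains r where "f rdvd r \<odot> w - 1"
proof -
  define I where "I = {r \<odot> w + s \<odot> f | r s. True}"
  have f: "f \<noteq> 0" using skew_irreducible_degree[OF irr] by blast
  have "w = 1 \<odot> w + 0 \<odot> f" "f = 0 \<odot> w + 1 \<odot> f" by simp_all
  then have wI: "w \<in> I" and fI: "f \<in> I" unfolding I_def by blast+
  have diff: "a - b \<in> I" if "a \<in> I" "b \<in> I" for a b
  proof -
    from that obtain r s r' s' where "a = r \<odot> w + s \<odot> f" "b = r' \<odot> w + s' \<odot> f"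
      unfolding I_def by auto
    then have "a - b = (r - r') \<odot> w + (s - s') \<odot> f" by (simp add: skew_distribs)
    then show ?thesis unfolding I_def by blast
  qed
  have mult: "a \<odot> b \<in> I" if "b \<in> I" for a b
  proof -
    from that obtain r s where "b = r \<odot> w + s \<odot> f" unfolding I_def by auto
    then have "a \<odot> b = (a \<odot> r) \<odot> w + (a \<odot> s) \<odot> f"
      by (simp add: skew_distribs skew_mult_assoc)
    then show ?thesis unfolding I_def by blast
  qed
  obtain g where g: "g \<in> I" "g \<noteq> 0" and gen: "\<And>r. r \<in> I \<Longrightarrow> g rdvd r"
    using left_ideal_generator[OF fI f diff mult] by blast
  obtain t where t: "f = t \<odot> g" using gen[OF fI] unfolding skew_right_dvd_def by blast
  have "\<not> skew_unit \<sigma> t"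
  proof
    assume "skew_unit \<sigma> t"
    then obtain t' where "t' \<odot> t = 1" unfolding skew_unit_def by blast
    then have "g = t' \<odot> f" by (metis t skew_mult_assoc skew_mult_1(1))
    then have "f rdvd g" by simp
    moreover obtain q where "w = q \<odot> g" using gen[OF wI] unfolding skew_right_dvd_def by blast
    ultimately show False using w rdvd_mult by blast
  qed
  then have "skew_unit \<sigma> g" using irr t unfolding skew_irreducible_def by blast
  then obtain g' where g': "g' \<odot> g = 1" unfolding skew_unit_def by blast
  obtain r s where "g = r \<odot> w + s \<odot> f" using g unfolding I_def by auto
  then have "1 = (g' \<odot> r) \<odot> w + (g' \<odot> s) \<odot> f"
    using g' by (simp add: skew_distribs skew_mult_assoc)
  then have "(g' \<odot> r) \<odot> w - 1 = (- (g' \<odot> s)) \<odot> f" by (simp add: minus_skew_mult algebra_simps)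
  then show thesis using that[of "g' \<odot> r"] by simp
qed

text \<open>If \<open>r w \<equiv> 1\<close> modulo \<open>f\<close> and \<open>g r \<in> R h\<close> is an Ore multiple, then \<open>g \<equiv> g r w \<equiv> 0\<close>, so
  \<open>deg f \<le> deg g \<le> deg h\<close>; no dimension count is needed.\<close>

lemma irreducible_annihilator_degree:
  assumes irr: "skew_irreducible \<sigma> f" and w: "\<not> f rdvd w"
    and h: "h \<noteq> 0" "f rdvd h \<odot> w"
  shows "degree f \<le> degree h"
proof -
  obtain r where r: "f rdvd r \<odot> w - 1" using irreducible_left_inverse[OF irr w] .
  obtain g where g: "g \<noteq> 0" "degree g \<le> degree h" "h rdvd g \<odot> r"
    using ore_condition[OF \<open>h \<noteq> 0\<close>, of r] by blast
  from g(3) obtain q where "g \<odot> r = q \<odot> h" unfolding skew_right_dvd_def by blast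
  then have "g \<odot> (r \<odot> w - 1) = q \<odot> (h \<odot> w) - g"
    by (metis skew_mult_diff skew_mult_assoc skew_mult_1(2))
  then have "f rdvd q \<odot> (h \<odot> w) - g" using rdvd_mult[OF r, of g] by simp
  then have "f rdvd g" using rdvd_diff_iff rdvd_mult[OF h(2), of q] by blast
  then show ?thesis using rdvd_degree g by fastforce
qed

text \<open>The condition f c \<in> R f is what makes right multiplication by \<open>c\<close> well
  defined on R/Rf.\<close>

lemma eigenring_rdvd: "c \<in> eigenring \<sigma> f \<Longrightarrow> f rdvd p \<Longrightarrow> f rdvd p \<odot> c"
  unfolding eigenring_def skew_right_dvd_def by (auto, metis skew_mult_assoc)

lemma eigenring_0: "0 < degree f \<Longrightarrow> 0 \<in> eigenring \<sigma> f"
  unfolding eigenring_def by simp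

lemma eigenring_minus_1: "0 < degree f \<Longrightarrow> - 1 \<in> eigenring \<sigma> f"
  unfolding eigenring_def by (simp add: skew_mult_minus rdvd_minus)

text \<open>The injective half of Schur's lemma. The remainder r of w modulo f still satisfies r c
  \<in> R f, but a nonzero skew polynomial killing the nonzero class of c has degree at least deg
  f.\<close>

lemma eigenring_cancel:
  assumes irr: "skew_irreducible \<sigma> f" and c: "c \<in> eigenring \<sigma> f" "c \<noteq> 0"
    and w: "f rdvd w \<odot> c"
  shows "f rdvd w"
proof -
  have f: "f \<noteq> 0" using skew_irreducible_degree[OF irr] by blast
  have nc: "\<not> f rdvd c" using c rdvd_degree unfolding eigenring_def by fastforce
  obtain q r where qr: "w = q \<odot> f + r" "r = 0 \<or> degree r < degree f"
    using skew_division[OF f] by blast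
  have "f rdvd (q \<odot> f) \<odot> c" using eigenring_rdvd[OF c(1)] by simp
  then have "f rdvd r \<odot> c" using rdvd_diff[OF w, of "(q \<odot> f) \<odot> c"] by (simp add: qr add_skew_mult)
  then have "r = 0" using irreducible_annihilator_degree[OF irr nc, of r] qr by fastforce
  then show ?thesis using qr by simp
qed

definition annihilator :: "'l poly \<Rightarrow> ('i \<Rightarrow> 'l poly) \<Rightarrow> 'i set \<Rightarrow> 'l poly set" where
  "annihilator f v J = {r. \<forall>j\<in>J. f rdvd r \<odot> v j}"

text \<open>Sums are formed in R and compared modulo R f, so that no reduced products occur. The
  index type is arbitrary because the notion serves for lists, for sets of columns and for a basis
  of L over K.\<close>

definition eigen_independent :: "'l poly \<Rightarrow> ('i \<Rightarrow> 'l poly) \<Rightarrow> 'i set \<Rightarrow> bool" where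
  "eigen_independent f v J \<longleftrightarrow>
     (\<forall>c. (\<forall>j\<in>J. c j \<in> eigenring \<sigma> f) \<and> f rdvd (\<Sum>j\<in>J. v j \<odot> c j) \<longrightarrow> (\<forall>j\<in>J. c j = 0))"

lemma annihilator_diff: "a \<in> annihilator f v J \<Longrightarrow> b \<in> annihilator f v J \<Longrightarrow> a - b \<in> annihilator f v J"
  unfolding annihilator_def by (simp add: diff_skew_mult rdvd_diff)

lemma annihilator_mult: "b \<in> annihilator f v J \<Longrightarrow> a \<odot> b \<in> annihilator f v J"
  unfolding annihilator_def by (simp add: skew_mult_assoc rdvd_mult)

lemma annihilator_lincomb:
  assumes "r \<in> annihilator f v J" "\<forall>j\<in>J. c j \<in> eigenring \<sigma> f"
  shows "f rdvd r \<odot> (\<Sum>j\<in>J. v j \<odot> c j)"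
  unfolding skew_mult_sum
proof (rule rdvd_sum)
  fix j assume "j \<in> J"
  then have "f rdvd (r \<odot> v j) \<odot> c j"
    using assms eigenring_rdvd[of "c j" f "r \<odot> v j"] unfolding annihilator_def by blast
  then show "f rdvd r \<odot> (v j \<odot> c j)" by (simp add: skew_mult_assoc)
qed

text \<open>Jacobson density for the simple module \<open>R/Rf\<close>: right multiplication by the residue of
  \<open>r\<^sub>0 u\<close>, where \<open>r\<^sub>0\<close> kills \<open>J\<close> and sends \<open>v x\<close> to 1, is the endomorphism that maps
  \<open>v x\<close> to \<open>u\<close>.\<close>

lemma density:
  assumes irr: "skew_irreducible \<sigma> f" and "finite J"
    and "\<And>r. r \<in> annihilator f v J \<Longrightarrow> f rdvd r \<odot> u"
  shows "\<exists>c. (\<forall>j\<in>J. c j \<in> eigenring \<sigma> f) \<and> f rdvd u - (\<Sum>j\<in>J. v j \<odot> c j)"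
  using assms(2,3)
proof (induction J arbitrary: u rule: finite_induct)
  case empty
  from empty[of 1] show ?case by (simp add: annihilator_def)
next
  case (insert x J)
  have df: "0 < degree f" using skew_irreducible_degree[OF irr] by blast
  have upd: "(\<Sum>j\<in>J. v j \<odot> (c(x := e)) j) = (\<Sum>j\<in>J. v j \<odot> c j)" for c e
    by (rule sum.cong) (use insert.hyps in auto)
  show ?case
  proof (cases "\<forall>r \<in> annihilator f v J. f rdvd r \<odot> v x")
    case True
    then have "f rdvd r \<odot> u" if "r \<in> annihilator f v J" for r
      using insert.prems that unfolding annihilator_def by auto
    from insert.IH[OF this] obtain c where
      c: "\<forall>j\<in>J. c j \<in> eigenring \<sigma> f" "f rdvd u - (\<Sum>j\<in>J. v j \<odot> c j)" by blast
    then show ?thesis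
      using insert.hyps eigenring_0[OF df]
      by (intro exI[of _ "c(x := 0)"]) (simp add: upd del: fun_upd_apply, simp)
  next
    case False
    then obtain r1 where r1: "r1 \<in> annihilator f v J" "\<not> f rdvd r1 \<odot> v x" by blast
    obtain r' where r': "f rdvd r' \<odot> (r1 \<odot> v x) - 1"
      using irreducible_left_inverse[OF irr r1(2)] .
    define r0 where "r0 = r' \<odot> r1"
    have r0J: "r0 \<in> annihilator f v J" unfolding r0_def by (rule annihilator_mult[OF r1(1)])
    have r0x: "f rdvd r0 \<odot> v x - 1" using r' by (simp add: r0_def skew_mult_assoc)
    define e where "e = skew_mod \<sigma> f (r0 \<odot> u)"
    have e: "degree e < degree f" "f rdvd r0 \<odot> u - e"
      using skew_mod_props[OF df] unfolding e_def by blast+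
    \<comment> \<open>Since r0 sends \<open>v x\<close> to 1 and kills \<open>J\<close>, the product
      f r0 kills both; the hypothesis on \<open>u\<close> then puts \<open>e\<close> into the
      eigenring.\<close>
    have "f rdvd f \<odot> (r0 \<odot> v x - 1) + f" by (intro rdvd_add rdvd_mult r0x) simp
    then have "f \<odot> r0 \<in> annihilator f v (insert x J)"
      using annihilator_mult[OF r0J, of f]
      by (simp add: annihilator_def skew_mult_assoc skew_mult_diff)
    then have "f rdvd f \<odot> (r0 \<odot> u)" using insert.prems skew_mult_assoc by metis
    then have "f rdvd f \<odot> e" using rdvd_diff_iff rdvd_mult[OF e(2), of f]
      by (metis skew_mult_diff)
    then have eE: "e \<in> eigenring \<sigma> f" using e unfolding eigenring_def by simp
    have "f rdvd r \<odot> (u - v x \<odot> e)" if r: "r \<in> annihilator f v J" for r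
    proof -
      let ?t = "r - (r \<odot> v x) \<odot> r0"
      have "f rdvd - ((r \<odot> v x) \<odot> (r0 \<odot> v x - 1))" by (simp add: rdvd_minus rdvd_mult r0x)
      then have "f rdvd ?t \<odot> v x" by (simp add: skew_distribs skew_mult_assoc)
      moreover have "?t \<in> annihilator f v J"
        by (intro annihilator_diff annihilator_mult r r0J)
      ultimately have "f rdvd ?t \<odot> u" by (intro insert.prems) (auto simp: annihilator_def)
      moreover have "f rdvd (r \<odot> v x) \<odot> (r0 \<odot> u - e)" by (rule rdvd_mult[OF e(2)])
      ultimately have "f rdvd ?t \<odot> u + (r \<odot> v x) \<odot> (r0 \<odot> u - e)" by (rule rdvd_add)
      then show ?thesis by (simp add: skew_distribs skew_mult_assoc)
    qed
    from insert.IH[OF this] obtain c where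
      c: "\<forall>j\<in>J. c j \<in> eigenring \<sigma> f" "f rdvd u - v x \<odot> e - (\<Sum>j\<in>J. v j \<odot> c j)" by blast
    then show ?thesis
      using insert.hyps eE
      by (intro exI[of _ "c(x := e)"]) (simp add: upd diff_diff_eq del: fun_upd_apply, simp)
  qed
qed

text \<open>Applying \<open>g\<close> to a relation removes every term except that of
  \<open>x\<close>, whose coefficient then vanishes by \<open>eigenring_cancel\<close>. This turns
  the maximality of an independent family into a statement about all vectors.\<close>

lemma eigen_independent_insert:
  assumes irr: "skew_irreducible \<sigma> f" and "finite J" "x \<notin> J" and ind: "eigen_independent f v J"
    and g: "g \<in> annihilator f v J" "\<not> f rdvd g \<odot> v x"
  shows "eigen_independent f v (insert x J)"
  unfolding eigen_independent_def
proof (intro allI impI)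
  fix c assume "(\<forall>j\<in>insert x J. c j \<in> eigenring \<sigma> f) \<and> f rdvd (\<Sum>j\<in>insert x J. v j \<odot> c j)"
  then have cE: "\<forall>j\<in>J. c j \<in> eigenring \<sigma> f" "c x \<in> eigenring \<sigma> f"
    and c: "f rdvd v x \<odot> c x + (\<Sum>j\<in>J. v j \<odot> c j)" using assms by auto
  have "f rdvd g \<odot> (v x \<odot> c x + (\<Sum>j\<in>J. v j \<odot> c j)) - g \<odot> (\<Sum>j\<in>J. v j \<odot> c j)"
    by (intro rdvd_diff rdvd_mult c annihilator_lincomb[OF g(1) cE(1)])
  then have "f rdvd (g \<odot> v x) \<odot> c x" by (simp add: skew_mult_add skew_mult_assoc)
  then have "c x = 0" using eigenring_cancel[OF irr cE(2)] g(2) by blast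
  then show "\<forall>j\<in>insert x J. c j = 0" using c cE ind unfolding eigen_independent_def by auto
qed

lemma eigen_independent_subset:
  assumes "finite J" "0 < degree f" "eigen_independent f v J" "I \<subseteq> J"
  shows "eigen_independent f v I"
  unfolding eigen_independent_def
proof (intro allI impI)
  fix c assume c: "(\<forall>j\<in>I. c j \<in> eigenring \<sigma> f) \<and> f rdvd (\<Sum>j\<in>I. v j \<odot> c j)"
  let ?c = "\<lambda>j. if j \<in> I then c j else 0"
  have "(\<Sum>j\<in>J. v j \<odot> ?c j) = (\<Sum>j\<in>I. v j \<odot> c j)"
    by (rule sum.mono_neutral_cong_right) (use assms in auto)
  moreover have "\<forall>j\<in>J. ?c j \<in> eigenring \<sigma> f" using c eigenring_0[OF assms(2)] by simp
  ultimately have *: "\<forall>j\<in>J. ?c j = 0"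
    using c
    by (intro assms(3)[unfolded eigen_independent_def, THEN spec, THEN mp] conjI) simp_all
  show "\<forall>j\<in>I. c j = 0"
  proof
    fix j assume "j \<in> I"
    with bspec[OF *, of j] assms(4) show "c j = 0" by auto
  qed
qed

text \<open>Each new vector costs exactly deg f. By density and independence the generator
  \<open>g\<close> for \<open>J\<close> does not kill \<open>v x\<close>, so an Ore multiplier
  \<open>h\<close> for g v_x has degree at most deg f, and at least deg f by irreducibility. Having
  least degree, h generates the annihilator of the class of g v_x, and h g that of the larger
  family.\<close>

lemma annihilator_degree:
  assumes irr: "skew_irreducible \<sigma> f" and "finite J" and "eigen_independent f v J"
  obtains g where "g \<in> annihilator f v J" "g \<noteq> 0" "degree g = card J * degree f"
    "\<And>r. r \<in> annihilator f v J \<Longrightarrow> g rdvd r"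
proof -
  have df: "0 < degree f" and f0: "f \<noteq> 0" using skew_irreducible_degree[OF irr] by blast+
  have "\<exists>g\<in>annihilator f v J. g \<noteq> 0 \<and> degree g = card J * degree f \<and>
    (\<forall>r\<in>annihilator f v J. g rdvd r)"
    using assms(2,3)
  proof (induction J rule: finite_induct)
    case empty
    have "1 rdvd r" for r using rdvd_self(2)[of 1 r] by simp
    then show ?case by (intro bexI[of _ 1]) (auto simp: annihilator_def)
  next
    case (insert x J)
    have "eigen_independent f v J"
      by (rule eigen_independent_subset[OF _ df insert.prems]) (use insert.hyps in auto)
    from insert.IH[OF this] obtain g where g: "g \<in> annihilator f v J" "g \<noteq> 0"
      "degree g = card J * degree f" and gen: "\<And>r. r \<in> annihilator f v J \<Longrightarrow> g rdvd r" by blast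
    have w: "\<not> f rdvd g \<odot> v x"
    proof
      assume "f rdvd g \<odot> v x"
      then have "f rdvd r \<odot> v x" if "r \<in> annihilator f v J" for r
        using gen[OF that] unfolding skew_right_dvd_def[of _ g] by (auto simp: skew_mult_assoc rdvd_mult)
      from density[OF irr insert.hyps(1) this] obtain c where
        c: "\<forall>j\<in>J. c j \<in> eigenring \<sigma> f" "f rdvd v x - (\<Sum>j\<in>J. v j \<odot> c j)" by blast
      \<comment> \<open>Density writes \<open>v x\<close> as a combination over \<open>J\<close>;
        the coefficient -1 at \<open>x\<close> turns this into a forbidden relation.\<close>
      let ?c = "c(x := - 1)"
      have "(\<Sum>j\<in>J. v j \<odot> ?c j) = (\<Sum>j\<in>J. v j \<odot> c j)"
        by (rule sum.cong) (use insert.hyps in auto)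
      then have "(\<Sum>j\<in>insert x J. v j \<odot> ?c j) = - (v x - (\<Sum>j\<in>J. v j \<odot> c j))"
        using insert.hyps by (simp add: skew_mult_minus)
      then have "f rdvd (\<Sum>j\<in>insert x J. v j \<odot> ?c j)" using c(2) by (simp only: rdvd_minus)
      moreover have "\<forall>j\<in>insert x J. ?c j \<in> eigenring \<sigma> f"
        using c(1) eigenring_minus_1[OF df] by auto
      ultimately have "?c x = 0" using insert.prems unfolding eigen_independent_def by blast
      then show False by simp
    qed
    obtain h where h: "h \<noteq> 0" "degree h \<le> degree f" "f rdvd h \<odot> (g \<odot> v x)"
      using ore_condition[OF f0] by blast
    have dh: "degree h = degree f"
      using irreducible_annihilator_degree[OF irr w h(1,3)] h(2) by simp
    have hg: "h \<odot> g \<in> annihilator f v (insert x J)"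
      using annihilator_mult[OF g(1), of h] h(3) by (simp add: annihilator_def skew_mult_assoc)
    have "h \<odot> g rdvd r" if r: "r \<in> annihilator f v (insert x J)" for r
    proof -
      have "r \<in> annihilator f v J" using r by (auto simp: annihilator_def)
      then obtain q where q: "r = q \<odot> g" using gen unfolding skew_right_dvd_def by blast
      obtain p t where pt: "q = p \<odot> h + t" "t = 0 \<or> degree t < degree h"
        using skew_division[OF h(1)] by blast
      have "f rdvd q \<odot> (g \<odot> v x) - p \<odot> (h \<odot> (g \<odot> v x))"
        by (rule rdvd_diff[OF _ rdvd_mult[OF h(3)]])
           (use r q in \<open>simp add: annihilator_def skew_mult_assoc\<close>)
      then have "f rdvd t \<odot> (g \<odot> v x)" by (simp add: pt add_skew_mult skew_mult_assoc)
      then have "t = 0" using irreducible_annihilator_degree[OF irr w, of t] pt dh by fastforce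
      then show ?thesis using q pt by (simp add: skew_mult_assoc)
    qed
    moreover have "degree (h \<odot> g) = card (insert x J) * degree f"
      using insert.hyps by (simp add: degree_skew_mult h(1) g(2,3) dh)
    ultimately show ?case using hg h(1) g(2) by (intro bexI[of _ "h \<odot> g"]) auto
  qed
  then show thesis using that by blast
qed


subsection \<open>Bases of \<open>R/Rf\<close> and the rank\<close>

lemma residue_eq_0: "degree p < degree f \<Longrightarrow> f rdvd p \<Longrightarrow> p = 0"
  using rdvd_degree[of f p] by auto

lemma mult_mod_props:
  assumes "0 < degree f"
  shows "degree (mult_mod \<sigma> f g h) < degree f" and "f rdvd g \<odot> h - mult_mod \<sigma> f g h"
  using skew_mod_props[OF assms] unfolding mult_mod_def by blast+

lemma right_lincomb_props:
  assumes df: "0 < degree f"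
  shows "degree (right_lincomb \<sigma> f bs c) < degree f"
    and "f rdvd (\<Sum>i<length bs. bs ! i \<odot> c i) - right_lincomb \<sigma> f bs c"
proof -
  show "degree (right_lincomb \<sigma> f bs c) < degree f"
    unfolding right_lincomb_def by (intro degree_sum_less mult_mod_props df)
  show "f rdvd (\<Sum>i<length bs. bs ! i \<odot> c i) - right_lincomb \<sigma> f bs c"
    unfolding right_lincomb_def sum_subtractf[symmetric] by (intro rdvd_sum mult_mod_props df)
qed

lemma right_lincomb_eq_iff:
  assumes df: "0 < degree f" and v: "degree v < degree f"
  shows "right_lincomb \<sigma> f bs c = v \<longleftrightarrow> f rdvd v - (\<Sum>i<length bs. bs ! i \<odot> c i)"
proof
  assume "right_lincomb \<sigma> f bs c = v"
  then show "f rdvd v - (\<Sum>i<length bs. bs ! i \<odot> c i)"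
    using right_lincomb_props(2)[OF df, of bs c] by (metis minus_diff_eq rdvd_minus)
next
  assume "f rdvd v - (\<Sum>i<length bs. bs ! i \<odot> c i)"
  from rdvd_add[OF this right_lincomb_props(2)[OF df, of bs c]]
  have "f rdvd v - right_lincomb \<sigma> f bs c" by simp
  then have "v - right_lincomb \<sigma> f bs c = 0"
    using residue_eq_0 degree_diff_less[OF v right_lincomb_props(1)[OF df]] by blast
  then show "right_lincomb \<sigma> f bs c = v" by simp
qed

lemma eigenring_basis_iff:
  assumes df: "0 < degree f"
  shows "eigenring_basis \<sigma> f bs \<longleftrightarrow> set bs \<subseteq> residues_mod f \<and>
    eigen_independent f ((!) bs) {..<length bs} \<and>
    (\<forall>v\<in>residues_mod f. \<exists>c. (\<forall>i<length bs. c i \<in> eigenring \<sigma> f) \<and>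
        f rdvd v - (\<Sum>i<length bs. bs ! i \<odot> c i))"
proof -
  have 0: "right_lincomb \<sigma> f bs c = 0 \<longleftrightarrow> f rdvd (\<Sum>i<length bs. bs ! i \<odot> c i)" for c
    using right_lincomb_eq_iff[OF df, of 0 bs c] df by (simp add: rdvd_minus)
  have v: "right_lincomb \<sigma> f bs c = v \<longleftrightarrow> f rdvd v - (\<Sum>i<length bs. bs ! i \<odot> c i)"
    if "v \<in> residues_mod f" for v c
    using right_lincomb_eq_iff[OF df] that by (simp add: residues_mod_def)
  show ?thesis
    unfolding eigenring_basis_def eigen_independent_def 0
    by (simp only: v lessThan_iff Ball_def cong: conj_cong imp_cong)
qed

lemma eigenring_mult_mod:
  assumes "c \<in> eigenring \<sigma> f" "d \<in> eigenring \<sigma> f"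
  shows "mult_mod \<sigma> f c d \<in> eigenring \<sigma> f"
proof -
  have df: "0 < degree f" using assms unfolding eigenring_def by auto
  have "f rdvd (f \<odot> c) \<odot> d" using assms unfolding eigenring_def
    by (intro eigenring_rdvd) (auto simp: eigenring_def)
  moreover have "f rdvd f \<odot> (c \<odot> d - mult_mod \<sigma> f c d)"
    by (rule rdvd_mult[OF mult_mod_props(2)[OF df]])
  ultimately have "f rdvd f \<odot> mult_mod \<sigma> f c d"
    using rdvd_diff_iff by (metis skew_mult_diff skew_mult_assoc)
  then show ?thesis using mult_mod_props(1)[OF df] by (simp add: eigenring_def)
qed

lemma eigenring_sum:
  assumes "0 < degree f" "\<And>i. i \<in> A \<Longrightarrow> c i \<in> eigenring \<sigma> f"
  shows "sum c A \<in> eigenring \<sigma> f"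
proof -
  have "degree (sum c A) < degree f"
    by (rule degree_sum_less) (use assms in \<open>auto simp: eigenring_def\<close>)
  moreover have "f rdvd f \<odot> sum c A"
    unfolding skew_mult_sum by (rule rdvd_sum) (use assms in \<open>auto simp: eigenring_def\<close>)
  ultimately show ?thesis by (simp add: eigenring_def)
qed

text \<open>Column j of \<open>M\<close> holds the coordinates of a b_j, so a right combination of
  columns holds those of the same combination of the a b_j. As \<open>bs\<close> is independent, the
  coordinates vanish exactly when that combination lies in R f.\<close>

lemma columns_independent_iff:
  assumes df: "0 < degree f" and bs: "eigenring_basis \<sigma> f bs"
    and M: "matrix_of \<sigma> f bs a M" and J: "J \<subseteq> {..<length bs}"
  shows "columns_independent \<sigma> f (length bs) M J \<longleftrightarrow> eigen_independent f (\<lambda>j. a \<odot> bs ! j) J"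
proof -
  let ?d = "length bs"
  have "(\<forall>i<?d. (\<Sum>j\<in>J. mult_mod \<sigma> f (M i j) (c j)) = 0) \<longleftrightarrow> f rdvd (\<Sum>j\<in>J. a \<odot> bs ! j \<odot> c j)"
    if c: "\<forall>j\<in>J. c j \<in> eigenring \<sigma> f" for c
  proof -
    have ME: "M i j \<in> eigenring \<sigma> f" if "i < ?d" "j \<in> J" for i j
      using M J that unfolding matrix_of_def by auto
    define e where "e i = (\<Sum>j\<in>J. mult_mod \<sigma> f (M i j) (c j))" for i
    have eE: "e i \<in> eigenring \<sigma> f" if "i < ?d" for i
      unfolding e_def by (rule eigenring_sum[OF df eigenring_mult_mod]) (use that ME c in auto)
    have 1: "f rdvd (a \<odot> bs ! j - (\<Sum>i<?d. bs ! i \<odot> M i j)) \<odot> c j" if j: "j \<in> J" for j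
    proof (rule eigenring_rdvd)
      have "f rdvd a \<odot> bs ! j - mult_mod \<sigma> f a (bs ! j)" by (rule mult_mod_props(2)[OF df])
      moreover have "mult_mod \<sigma> f a (bs ! j) = right_lincomb \<sigma> f bs (\<lambda>i. M i j)"
        using M J j unfolding matrix_of_def by auto
      ultimately have "f rdvd a \<odot> bs ! j - right_lincomb \<sigma> f bs (\<lambda>i. M i j)" by simp
      from rdvd_diff[OF this right_lincomb_props(2)[OF df, of bs "\<lambda>i. M i j"]]
      show "f rdvd a \<odot> bs ! j - (\<Sum>i<?d. bs ! i \<odot> M i j)" by simp
    qed (use c j in blast)
    have 2: "f rdvd (\<Sum>i<?d. bs ! i \<odot> ((\<Sum>j\<in>J. M i j \<odot> c j) - e i))"
      unfolding e_def sum_subtractf[symmetric]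
      by (intro rdvd_sum rdvd_mult mult_mod_props(2)[OF df])
    have "(\<Sum>j\<in>J. (\<Sum>i<?d. bs ! i \<odot> M i j) \<odot> c j) = (\<Sum>i<?d. bs ! i \<odot> (\<Sum>j\<in>J. M i j \<odot> c j))"
      by (simp add: sum_skew_mult skew_mult_sum skew_mult_assoc sum.swap[of _ J])
    \<comment> \<open>Both errors are multiples of f: that of expanding a b_j in the basis, which
      survives multiplication by the eigenring element \<open>c j\<close>, and that of reducing the
      products of entries.\<close>
    then have "(\<Sum>j\<in>J. a \<odot> bs ! j \<odot> c j) - (\<Sum>i<?d. bs ! i \<odot> e i)
        = (\<Sum>j\<in>J. (a \<odot> bs ! j - (\<Sum>i<?d. bs ! i \<odot> M i j)) \<odot> c j)
          + (\<Sum>i<?d. bs ! i \<odot> ((\<Sum>j\<in>J. M i j \<odot> c j) - e i))"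
      by (simp add: diff_skew_mult skew_mult_diff sum_subtractf)
    then have "f rdvd (\<Sum>j\<in>J. a \<odot> bs ! j \<odot> c j) - (\<Sum>i<?d. bs ! i \<odot> e i)"
      using rdvd_add[OF rdvd_sum[OF 1] 2] by simp
    then have *: "f rdvd (\<Sum>j\<in>J. a \<odot> bs ! j \<odot> c j) \<longleftrightarrow> f rdvd (\<Sum>i<?d. bs ! i \<odot> e i)"
      by (rule rdvd_diff_iff)
    have "(\<forall>i<?d. e i = 0)" if "f rdvd (\<Sum>i<?d. bs ! i \<odot> e i)"
      using bs that eE unfolding eigenring_basis_iff[OF df] eigen_independent_def by auto
    moreover have "f rdvd (\<Sum>i<?d. bs ! i \<odot> e i)" if "\<forall>i<?d. e i = 0"
      using that by (intro rdvd_sum) auto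
    ultimately show ?thesis unfolding * e_def[symmetric] by blast
  qed
  then show ?thesis unfolding columns_independent_def eigen_independent_def by blast
qed

definition annihilates :: "'l poly \<Rightarrow> 'l poly \<Rightarrow> bool" where
  "annihilates f r \<longleftrightarrow> (\<forall>v. f rdvd r \<odot> v)"

lemma annihilatesI:
  assumes df: "0 < degree f" and bs: "eigenring_basis \<sigma> f bs"
    and r: "\<And>i. i < length bs \<Longrightarrow> f rdvd r \<odot> bs ! i"
  shows "annihilates f r"
  unfolding annihilates_def
proof
  fix v
  let ?w = "skew_mod \<sigma> f v"
  have "?w \<in> residues_mod f" using skew_mod_props(1)[OF df] by (simp add: residues_mod_def)
  then obtain c where c: "\<forall>i<length bs. c i \<in> eigenring \<sigma> f"
    "f rdvd ?w - (\<Sum>i<length bs. bs ! i \<odot> c i)"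
    using bs unfolding eigenring_basis_iff[OF df] by blast
  have "f rdvd r \<odot> (\<Sum>i<length bs. bs ! i \<odot> c i)"
    by (rule annihilator_lincomb) (use r c in \<open>auto simp: annihilator_def\<close>)
  from rdvd_add[OF this rdvd_add[OF rdvd_mult[OF c(2), of r]
        rdvd_mult[OF skew_mod_props(2)[OF df, of v], of r]]]
  show "f rdvd r \<odot> v" by (simp add: skew_mult_diff)
qed

text \<open>\<open>p\<close> bounds the length of an independent list: it lies in the annihilator,
  whose generator has degree length times deg f. A list of maximal length spans: by density, a
  vector outside the span is not killed by some element that kills the list, so it could be
  appended.\<close>

lemma eigenring_basis_exists:
  assumes irr: "skew_irreducible \<sigma> f" and p: "p \<noteq> 0" "annihilates f p"
  shows "\<exists>bs. eigenring_basis \<sigma> f bs"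
proof -
  have df: "0 < degree f" using skew_irreducible_degree[OF irr] by blast
  let ?P = "\<lambda>bs. set bs \<subseteq> residues_mod f \<and> eigen_independent f ((!) bs) {..<length bs}"
  have bound: "length bs \<le> degree p" if "?P bs" for bs
  proof -
    have fin: "finite {..<length bs}" by simp
    from that obtain g where "g \<noteq> 0" "degree g = card {..<length bs} * degree f"
      "\<And>r. r \<in> annihilator f ((!) bs) {..<length bs} \<Longrightarrow> g rdvd r"
      using annihilator_degree[OF irr fin] by blast
    moreover have "p \<in> annihilator f ((!) bs) {..<length bs}"
      using p by (simp add: annihilator_def annihilates_def)
    ultimately have "length bs * degree f \<le> degree p" using rdvd_degree p by fastforce
    then show ?thesis using df by (cases "degree f") auto
  qed
  have "?P []" by (simp add: eigen_independent_def)
  moreover have "\<forall>bs. ?P bs \<longrightarrow> length bs < Suc (degree p)" using bound by (simp add: less_Suc_eq_le)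
  ultimately have "\<exists>bs. ?P bs \<and> (\<forall>bs'. ?P bs' \<longrightarrow> length bs' \<le> length bs)"
    by (rule Lattices_Big.ex_has_greatest_nat)
  then obtain bs where bs: "?P bs" and max: "\<And>bs'. ?P bs' \<Longrightarrow> length bs' \<le> length bs"
    by blast
  have "\<exists>c. (\<forall>i<length bs. c i \<in> eigenring \<sigma> f) \<and> f rdvd v - (\<Sum>i<length bs. bs ! i \<odot> c i)"
    if v: "v \<in> residues_mod f" for v
  proof (rule ccontr)
    assume no: "\<nexists>c. (\<forall>i<length bs. c i \<in> eigenring \<sigma> f) \<and> f rdvd v - (\<Sum>i<length bs. bs ! i \<odot> c i)"
    obtain g where g: "g \<in> annihilator f ((!) bs) {..<length bs}" "\<not> f rdvd g \<odot> v"
      using density[OF irr, of "{..<length bs}" "(!) bs" v] no by auto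
    let ?bs = "bs @ [v]"
    have "eigen_independent f ((!) ?bs) (insert (length bs) {..<length bs})"
    proof (rule eigen_independent_insert[OF irr])
      show "eigen_independent f ((!) ?bs) {..<length bs}"
        using bs unfolding eigen_independent_def by (simp add: nth_append)
      show "g \<in> annihilator f ((!) ?bs) {..<length bs}"
        using g(1) by (simp add: annihilator_def nth_append)
    qed (use g in auto)
    moreover have "insert (length bs) {..<length bs} = {..<length ?bs}" by auto
    ultimately have "?P ?bs" using bs v by auto
    from max[OF this] show False by simp
  qed
  then show ?thesis using bs unfolding eigenring_basis_iff[OF df] by blast
qed

lemma annihilates_generator:
  assumes irr: "skew_irreducible \<sigma> f" and bs: "eigenring_basis \<sigma> f bs"
  obtains g where "annihilates f g" "g \<noteq> 0" "degree g = length bs * degree f"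
    "\<And>r. annihilates f r \<Longrightarrow> g rdvd r"
proof -
  have df: "0 < degree f" using skew_irreducible_degree[OF irr] by blast
  obtain g where g: "g \<in> annihilator f ((!) bs) {..<length bs}" "g \<noteq> 0"
    "degree g = card {..<length bs} * degree f"
    "\<And>r. r \<in> annihilator f ((!) bs) {..<length bs} \<Longrightarrow> g rdvd r"
    using annihilator_degree[OF irr, of "{..<length bs}" "(!) bs"] bs
    unfolding eigenring_basis_iff[OF df] by auto
  show thesis
  proof (rule that)
    show "annihilates f g" using annihilatesI[OF df bs] g(1) by (simp add: annihilator_def)
    show "g rdvd r" if "annihilates f r" for r
      by (rule g(4)) (use that in \<open>simp add: annihilates_def annihilator_def\<close>)
  qed (use g in auto)
qed

text \<open>Take an independent set \<open>J\<close> of columns whose size is the rank. The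
  generator \<open>g\<close> of the annihilator of the a b_j with j in \<open>J\<close> has the
  right degree, and it kills the other a b_i too, since a column it did not kill could be added to
  \<open>J\<close>.\<close>

lemma skew_rank_annihilator:
  assumes irr: "skew_irreducible \<sigma> f" and p: "p \<noteq> 0" "annihilates f p"
  obtains g where "g \<noteq> 0" "degree g = skew_rank \<sigma> f a * degree f" "annihilates f (g \<odot> a)"
proof -
  have df: "0 < degree f" using skew_irreducible_degree[OF irr] by blast
  define bs where "bs = (SOME bs. eigenring_basis \<sigma> f bs)"
  have bs: "eigenring_basis \<sigma> f bs"
    unfolding bs_def by (rule someI_ex[OF eigenring_basis_exists[OF irr p]])
  define M where "M = (SOME M. matrix_of \<sigma> f bs a M)"
  have "\<forall>j. \<exists>c. (\<forall>i<length bs. c i \<in> eigenring \<sigma> f) \<and> right_lincomb \<sigma> f bs c = mult_mod \<sigma> f a (bs ! j)"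
    using bs mult_mod_props(1)[OF df] unfolding eigenring_basis_def residues_mod_def by blast
  then obtain C where "\<forall>j. (\<forall>i<length bs. C j i \<in> eigenring \<sigma> f) \<and>
      right_lincomb \<sigma> f bs (C j) = mult_mod \<sigma> f a (bs ! j)" by metis
  then have "matrix_of \<sigma> f bs a (\<lambda>i j. C j i)" unfolding matrix_of_def by simp
  then have M: "matrix_of \<sigma> f bs a M" unfolding M_def by (rule someI[of "matrix_of \<sigma> f bs a"])
  let ?S = "{J. J \<subseteq> {..<length bs} \<and> columns_independent \<sigma> f (length bs) M J}"
  have fin: "finite ?S" by simp
  have rank: "skew_rank \<sigma> f a = Max (card ` ?S)"
    unfolding skew_rank_def bs_def[symmetric] Let_def M_def[symmetric] matrix_rank_def
    by (rule arg_cong[of _ _ Max]) blast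
  have "{} \<in> ?S" by (simp add: columns_independent_def)
  then have "Max (card ` ?S) \<in> card ` ?S" using fin by (intro Max_in) auto
  then obtain J where J: "J \<in> ?S" "card J = skew_rank \<sigma> f a" using rank by auto
  let ?v = "\<lambda>j. a \<odot> bs ! j"
  have finJ: "finite J" using J finite_subset by blast
  have indJ: "eigen_independent f ?v J" using J columns_independent_iff[OF df bs M] by blast
  obtain g where g: "g \<in> annihilator f ?v J" "g \<noteq> 0" "degree g = card J * degree f"
    using annihilator_degree[OF irr finJ indJ] by blast
  have "f rdvd g \<odot> ?v i" if i: "i < length bs" for i
  proof (cases "i \<in> J")
    case True
    then show ?thesis using g by (simp add: annihilator_def)
  next
    case False
    show ?thesis
    proof (rule ccontr)
      assume "\<not> f rdvd g \<odot> ?v i"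
      then have "eigen_independent f ?v (insert i J)"
        using eigen_independent_insert[OF irr finJ False indJ g(1)] by blast
      then have "insert i J \<in> ?S" using columns_independent_iff[OF df bs M] J i by simp
      then have "card (insert i J) \<le> skew_rank \<sigma> f a" unfolding rank using fin by (intro Max_ge) auto
      then show False using J(2) False finJ by simp
    qed
  qed
  then have "annihilates f (g \<odot> a)" by (intro annihilatesI[OF df bs]) (simp add: skew_mult_assoc)
  then show thesis using that g J(2) by simp
qed


section \<open>Special products and two-sided ideals\<close>

lemma skew_mult_fixed: "(\<And>j. \<sigma> (coeff q j) = coeff q j) \<Longrightarrow> p \<odot> q = p * q"
proof (rule poly_eqI)
  fix k assume q: "\<And>j. \<sigma> (coeff q j) = coeff q j"
  have "(\<sigma> ^^ i) (coeff q j) = coeff q j" for i j by (induction i) (auto simp: q)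
  then show "coeff (p \<odot> q) k = coeff (p * q) k" by (simp add: coeff_skew_mult coeff_mult)
qed

lemma skew_mult_x: "p \<odot> [:0, 1:] = pCons 0 p"
  by (subst skew_mult_fixed) (simp_all add: coeff_pCons split: nat.split)

lemma coeff_skew_mult_const: "coeff (p \<odot> [:b:]) i = coeff p i * (\<sigma> ^^ i) b"
proof -
  have "coeff (p \<odot> [:b:]) i = (\<Sum>j\<in>{i}. coeff p j * (\<sigma> ^^ j) (coeff [:b:] (i - j)))"
    unfolding coeff_skew_mult
    by (rule sum.mono_neutral_right) (auto simp: coeff_pCons split: nat.split)
  then show ?thesis by simp
qed

lemma coeff_skew_mult_0: "coeff (p \<odot> q) 0 = coeff p 0 * coeff q 0"
  by (simp add: coeff_skew_mult)

lemma coeff_linear_skew_mult: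
  "coeff ([:c0, c1:] \<odot> p) (Suc k) = c0 * coeff p (Suc k) + c1 * \<sigma> (coeff p k)"
proof -
  have "coeff ([:c0, c1:] \<odot> p) (Suc k)
      = (\<Sum>i\<in>{0, 1}. coeff [:c0, c1:] i * (\<sigma> ^^ i) (coeff p (Suc k - i)))"
    unfolding coeff_skew_mult
    by (rule sum.mono_neutral_right) (auto simp: coeff_pCons split: nat.split)
  then show ?thesis by simp
qed

lemma x_skew_mult_const: "[:0, 1:] \<odot> [:b:] = [:0, \<sigma> b:]"
  using coeff_skew_mult_const[of "[:0, 1:]" b]
  by (auto simp: poly_eq_iff coeff_pCons split: nat.split)

lemma const_skew_mult_const: "[:a:] \<odot> [:b:] = [:a * b:]"
  by (simp add: skew_mult_const)

text \<open>For b \<noteq> 0, the degrees in g b = q g make q a constant c. The constant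
  coefficients give c = b, because that of \<open>g\<close> is nonzero, and the coefficients at
  \<open>i\<close> give the claim.\<close>

lemma two_sided_const:
  assumes "coeff g 0 \<noteq> 0" "g rdvd g \<odot> [:b:]" "coeff g i \<noteq> 0"
  shows "(\<sigma> ^^ i) b = b"
proof (cases "b = 0")
  case False
  from assms(2) obtain q where q: "g \<odot> [:b:] = q \<odot> g" unfolding skew_right_dvd_def by blast
  have "g \<noteq> 0" using assms by auto
  have "q \<odot> g \<noteq> 0" unfolding q[symmetric] using \<open>g \<noteq> 0\<close> False by simp
  then have "q \<noteq> 0" by auto
  have "degree q = 0"
    using degree_skew_mult[OF \<open>q \<noteq> 0\<close> \<open>g \<noteq> 0\<close>] degree_skew_mult[OF \<open>g \<noteq> 0\<close>, of "[:b:]"] False q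
    by simp
  then obtain c where c: "q = [:c:]" by (metis degree_eq_zeroE)
  have eq: "coeff g j * (\<sigma> ^^ j) b = c * coeff g j" for j
    using arg_cong[OF q, of "\<lambda>p. coeff p j"]
    by (simp add: coeff_skew_mult_const c skew_mult_const)
  have "c = b" using eq[of 0] assms(1) by (simp add: mult.commute)
  then show ?thesis using eq[of i] assms(3) by (simp add: mult.commute)
qed simp

text \<open>Here g x = q g with q = c0 + c1 x. The constant coefficients force c0 = 0, and the
  leading ones c1 = 1 as \<open>g\<close> is monic; the remaining equations are the claim.\<close>

lemma two_sided_x:
  assumes "coeff g 0 \<noteq> 0" "g rdvd g \<odot> [:0, 1:]" "lead_coeff g = 1"
  shows "\<sigma> (coeff g i) = coeff g i"
proof -
  from assms(2) obtain q where q: "pCons 0 g = q \<odot> g"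
    unfolding skew_right_dvd_def skew_mult_x by blast
  have "g \<noteq> 0" using assms by auto
  then have "q \<noteq> 0" using q by auto
  have "degree q = 1"
    using degree_skew_mult[OF \<open>q \<noteq> 0\<close> \<open>g \<noteq> 0\<close>] \<open>g \<noteq> 0\<close> by (simp flip: q)
  then have "q = [:coeff q 0, coeff q 1:]"
    by (auto simp: poly_eq_iff coeff_pCons coeff_eq_0 split: nat.split)
  then obtain c0 c1 where c: "q = [:c0, c1:]" by blast
  have "c0 * coeff g 0 = 0"
    using arg_cong[OF q, of "\<lambda>p. coeff p 0"] by (simp add: coeff_skew_mult_0 c)
  then have "c0 = 0" using assms(1) by simp
  then have eq: "coeff g k = c1 * \<sigma> (coeff g k)" for k
    using arg_cong[OF q, of "\<lambda>p. coeff p (Suc k)"] by (simp add: coeff_linear_skew_mult c)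
  have "c1 = 1" using eq[of "degree g"] assms(3) by simp
  then show ?thesis using eq[of i] by simp
qed

text \<open>Let x act on L as \<sigma> and constants by multiplication. Then x - 1 kills the element
  1, and R/R(x - 1) is L, the class of a skew polynomial being the sum of its left
  coefficients.\<close>

definition x_minus_1 :: "'l poly" where "x_minus_1 = [:- 1, 1:]"

lemma x_minus_1_irreducible: "skew_irreducible \<sigma> x_minus_1"
  unfolding skew_irreducible_def skew_unit_iff
proof (intro conjI allI impI)
  fix g h assume gh: "x_minus_1 = g \<odot> h"
  then have "g \<odot> h \<noteq> 0" by (auto simp: x_minus_1_def)
  then have "g \<noteq> 0" "h \<noteq> 0" by auto
  from degree_skew_mult[OF this] have "degree g + degree h = 1"
    by (simp add: gh[symmetric]) (simp add: x_minus_1_def)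
  then show "g \<noteq> 0 \<and> degree g = 0 \<or> h \<noteq> 0 \<and> degree h = 0"
    using \<open>g \<noteq> 0\<close> \<open>h \<noteq> 0\<close> by auto
qed (simp_all add: x_minus_1_def)

lemma x_minus_1_rdvd_const: "x_minus_1 rdvd [:c:] \<longleftrightarrow> c = 0"
  using residue_eq_0[of "[:c:]" x_minus_1] by (auto simp: x_minus_1_def)

lemma x_minus_1_rdvd_monom: "x_minus_1 rdvd monom c i - [:c:]"
proof (induction i)
  case 0
  then show ?case by (simp add: monom_0)
next
  case (Suc i)
  have "x_minus_1 = [:0, 1:] - 1" by (simp add: x_minus_1_def one_pCons)
  then have "monom c i \<odot> x_minus_1 = monom c i \<odot> [:0, 1:] - monom c i"
    by (metis skew_mult_diff skew_mult_1(2))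
  then have "monom c (Suc i) - monom c i = monom c i \<odot> x_minus_1"
    by (simp add: skew_mult_x monom_Suc)
  then have "x_minus_1 rdvd monom c (Suc i) - monom c i" by simp
  from rdvd_add[OF this Suc] show ?case by (metis add_diff_eq diff_add_cancel)
qed

text \<open>Modulo x - 1, the product (x - 1) c = \<sigma>(c) x - c is the constant \<sigma>(c) - c,
  and the only constant in R(x - 1) is 0.\<close>

lemma eigenring_x_minus_1: "e \<in> eigenring \<sigma> x_minus_1 \<longleftrightarrow> (\<exists>c. e = [:c:] \<and> \<sigma> c = c)"
proof -
  have "x_minus_1 rdvd x_minus_1 \<odot> [:c:] \<longleftrightarrow> \<sigma> c = c" for c
  proof -
    have "x_minus_1 \<odot> [:c:] = [:0, 1:] \<odot> [:c:] - 1 \<odot> [:c:]"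
      unfolding diff_skew_mult[symmetric] by (simp add: x_minus_1_def one_pCons)
    also have "\<dots> = (monom (\<sigma> c) 1 - [:\<sigma> c:]) + [:\<sigma> c - c:]"
      by (simp add: x_skew_mult_const monom_Suc monom_0)
    finally have "x_minus_1 rdvd x_minus_1 \<odot> [:c:] - [:\<sigma> c - c:]"
      using x_minus_1_rdvd_monom[of "\<sigma> c" 1] by simp
    from rdvd_diff_iff[OF this] show ?thesis by (simp add: x_minus_1_rdvd_const)
  qed
  moreover have "degree e < degree x_minus_1 \<longleftrightarrow> (\<exists>c. e = [:c:])"
  proof -
    have "degree e < degree x_minus_1 \<longleftrightarrow> degree e = 0" by (simp add: x_minus_1_def)
    then show ?thesis by (metis degree_eq_zeroE degree_pCons_0)
  qed
  ultimately show ?thesis unfolding eigenring_def by blast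
qed

end

section \<open>Cyclic extensions\<close>

locale cyclic_extension =
  fixes \<iota> :: "'k::field \<Rightarrow> 'l::field" and n :: nat and \<sigma> :: "'l \<Rightarrow> 'l"
  assumes cyclic: "cyclic_galois_extension \<iota> n \<sigma>"
begin

sublocale skew_ring \<sigma>
  using cyclic by unfold_locales (simp add: cyclic_galois_extension_def galois_group_def)

lemma n_pos: "0 < n"
  using cyclic by (simp add: cyclic_galois_extension_def)

lemma \<iota>_add: "\<iota> (x + y) = \<iota> x + \<iota> y" and \<iota>_mult: "\<iota> (x * y) = \<iota> x * \<iota> y" and \<iota>_1 [simp]: "\<iota> 1 = 1"
  using cyclic by (simp_all add: cyclic_galois_extension_def ring_homomorphism_def)

lemma \<iota>_0 [simp]: "\<iota> 0 = 0"
  using \<iota>_add[of 0 0] by (metis add_cancel_right_right add_0)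

lemma \<iota>_eq_0_iff [simp]: "\<iota> x = 0 \<longleftrightarrow> x = 0"
proof
  assume "\<iota> x = 0"
  then show "x = 0" using \<iota>_mult[of x "inverse x"] by (cases "x = 0") auto
qed simp

lemma inj_\<iota>: "inj \<iota>"
proof (rule injI)
  fix x y assume "\<iota> x = \<iota> y"
  then have "\<iota> (x - y) = 0" using \<iota>_add[of "x - y" y] by simp
  then show "x = y" by simp
qed

lemma \<sigma>_carrier: "\<sigma> \<in> carrier (galois_group \<iota>)"
  using cyclic by (simp add: cyclic_galois_extension_def)

lemma \<sigma>_\<iota> [simp]: "\<sigma> (\<iota> c) = \<iota> c" and bij_\<sigma>: "bij \<sigma>"
  using \<sigma>_carrier by (simp_all add: galois_group_def)

lemma pow_\<sigma>_carrier: "\<sigma> ^^ i \<in> carrier (galois_group \<iota>)"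
proof -
  have "(\<sigma> ^^ i) (\<iota> c) = \<iota> c" for c by (induction i) auto
  then show ?thesis
    using bij_\<sigma> by (simp add: galois_group_def ring_homomorphism_def pow_add pow_mult bij_betw_funpow)
qed

text \<open>\<open>galois_group\<close> is a bare monoid record, and \<open>generate\<close> takes
  inverses through the definite description in \<open>m_inv\<close>. This must be identified with
  the inverse function before the clause for inverses can be used.\<close>

lemma galois_group_m_inv:
  assumes \<tau>: "\<tau> \<in> carrier (galois_group \<iota>)"
  shows "(inv\<^bsub>galois_group \<iota>\<^esub> \<tau>) \<circ> \<tau> = id"
proof -
  let ?i = "inv_into UNIV \<tau>"
  have bij: "bij \<tau>" and hom: "ring_homomorphism \<tau>" and fx: "\<And>c. \<tau> (\<iota> c) = \<iota> c"
    using \<tau> by (auto simp: galois_group_def)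
  have s: "\<tau> (?i x) = x" and i: "?i (\<tau> x) = x" for x
    using bij by (simp_all add: bij_is_surj surj_f_inv_f bij_is_inj)
  have inj: "x = y" if "\<tau> x = \<tau> y" for x y using that i by metis
  have "?i 1 = 1" "?i (x + y) = ?i x + ?i y" "?i (x * y) = ?i x * ?i y" "?i (\<iota> c) = \<iota> c" for x y c
    by (rule inj; use hom fx in \<open>simp add: s ring_homomorphism_def\<close>)+
  then have car: "?i \<in> carrier (galois_group \<iota>)"
    using bij by (simp add: galois_group_def ring_homomorphism_def bij_imp_bij_inv)
  have "(inv\<^bsub>galois_group \<iota>\<^esub> \<tau>) = ?i"
    unfolding m_inv_def
  proof (rule the_equality)
    show "?i \<in> carrier (galois_group \<iota>) \<and> \<tau> \<otimes>\<^bsub>galois_group \<iota>\<^esub> ?i = \<one>\<^bsub>galois_group \<iota>\<^esub>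
        \<and> ?i \<otimes>\<^bsub>galois_group \<iota>\<^esub> \<tau> = \<one>\<^bsub>galois_group \<iota>\<^esub>"
      using car by (auto simp: galois_group_def s i)
  next
    fix y assume "y \<in> carrier (galois_group \<iota>) \<and> \<tau> \<otimes>\<^bsub>galois_group \<iota>\<^esub> y = \<one>\<^bsub>galois_group \<iota>\<^esub>
        \<and> y \<otimes>\<^bsub>galois_group \<iota>\<^esub> \<tau> = \<one>\<^bsub>galois_group \<iota>\<^esub>"
    then have "\<tau> (y x) = x" for x by (simp add: galois_group_def fun_eq_iff)
    then show "y = ?i" using inj s by (intro ext) metis
  qed
  then show ?thesis using i by auto
qed

lemma galois_group_induct [consumes 1, case_names id \<sigma> inv comp]:
  assumes "\<tau> \<in> carrier (galois_group \<iota>)" and "P id" and "P \<sigma>"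
    and "\<And>\<rho>. \<rho> \<circ> \<sigma> = id \<Longrightarrow> P \<rho>" and "\<And>\<rho> \<tau>. P \<rho> \<Longrightarrow> P \<tau> \<Longrightarrow> P (\<rho> \<circ> \<tau>)"
  shows "P \<tau>"
proof -
  have "\<tau> \<in> generate (galois_group \<iota>) {\<sigma>}"
    using assms(1) cyclic by (simp add: cyclic_galois_extension_def)
  then show ?thesis
  proof induction
    case one
    then show ?case using \<open>P id\<close> by (simp add: galois_group_def id_def)
  next
    case (incl h)
    then show ?case using assms by simp
  next
    case (inv h)
    then show ?case using assms galois_group_m_inv[OF \<sigma>_carrier] by simp
  next
    case (eng h1 h2)
    from eng.IH have "P (h1 \<circ> h2)" by (rule assms(5))
    then show ?case by (simp add: galois_group_def o_def)
  qed
qed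

lemma fixed_iff: "\<sigma> x = x \<longleftrightarrow> x \<in> range \<iota>"
proof
  assume x: "\<sigma> x = x"
  have "\<tau> x = x" if "\<tau> \<in> carrier (galois_group \<iota>)" for \<tau>
    using that
  proof (induction rule: galois_group_induct)
    case (inv \<rho>)
    from fun_cong[OF inv, of x] show ?case by (simp add: x)
  qed (simp_all add: x)
  moreover have "{x. \<forall>\<tau>\<in>carrier (galois_group \<iota>). \<tau> x = x} = range \<iota>"
    using cyclic by (simp add: cyclic_galois_extension_def)
  ultimately show "x \<in> range \<iota>" by blast
qed auto

text \<open>As a left \<open>R\<close>-module, L is \<open>R/R(x - 1)\<close>, with eigenring K. Density then says that the
  annihilator of L is generated by a skew polynomial of degree \<open>n\<close>; this replaces the
  theorems of Artin and Dedekind.\<close>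

lemma annihilator_of_L:
  obtains g where "degree g = n" "g \<noteq> 0" "\<And>b. x_minus_1 rdvd g \<odot> [:b:]"
    "\<And>r. (\<And>b. x_minus_1 rdvd r \<odot> [:b:]) \<Longrightarrow> g rdvd r"
proof -
  interpret vs: vector_space "\<lambda>c x. \<iota> c * x"
    by unfold_locales (simp_all add: algebra_simps \<iota>_add \<iota>_mult)
  obtain B where B: "vs.independent B" "UNIV \<subseteq> vs.span B" "card B = vs.dim UNIV"
    using vs.basis_exists[of UNIV] by metis
  have cardB: "card B = n"
    using B cyclic by (simp add: cyclic_galois_extension_def extension_degree_def)
  then have finB: "finite B" using n_pos card_ge_0_finite by metis
  have lin: "(\<Sum>b\<in>B. [:b:] \<odot> [:u b:]) = [:\<Sum>b\<in>B. u b * b:]" for u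
    using finB by (induction B rule: finite_induct)
      (simp_all add: const_skew_mult_const mult.commute)
  \<comment> \<open>The eigenring of x - 1 consists of the constants from K, so this is the linear
    independence of \<open>B\<close> over K.\<close>
  have ind: "eigen_independent x_minus_1 (\<lambda>b. [:b:]) B"
    unfolding eigen_independent_def
  proof (intro allI impI)
    fix c assume c: "(\<forall>j\<in>B. c j \<in> eigenring \<sigma> x_minus_1) \<and> x_minus_1 rdvd (\<Sum>j\<in>B. [:j:] \<odot> c j)"
    then have "\<forall>j\<in>B. \<exists>k. c j = [:\<iota> k:]" unfolding eigenring_x_minus_1 fixed_iff by blast
    then obtain k where k: "\<forall>j\<in>B. c j = [:\<iota> (k j):]" by metis
    then have "(\<Sum>j\<in>B. [:j:] \<odot> c j) = (\<Sum>j\<in>B. [:j:] \<odot> [:\<iota> (k j):])" by (intro sum.cong) auto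
    then have "(\<Sum>j\<in>B. \<iota> (k j) * j) = 0" using c by (simp add: lin x_minus_1_rdvd_const)
    then have "\<forall>j\<in>B. k j = 0" using vs.independentD[OF B(1) finB order_refl] by blast
    then show "\<forall>j\<in>B. c j = 0" using k by simp
  qed
  obtain g where g: "g \<in> annihilator x_minus_1 (\<lambda>b. [:b:]) B" "g \<noteq> 0"
    "degree g = card B * degree x_minus_1"
    "\<And>r. r \<in> annihilator x_minus_1 (\<lambda>b. [:b:]) B \<Longrightarrow> g rdvd r"
    using annihilator_degree[OF x_minus_1_irreducible finB ind] by blast
  show thesis
  proof (rule that)
    show "degree g = n" using g(3) cardB by (simp add: x_minus_1_def)
    show "x_minus_1 rdvd g \<odot> [:b:]" for b
    proof -
      obtain u where "b = (\<Sum>v\<in>B. \<iota> (u v) * v)" using B(2) unfolding vs.span_finite[OF finB] by blast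
      then have "[:b:] = (\<Sum>v\<in>B. [:v:] \<odot> [:\<iota> (u v):])" by (simp add: lin)
      then show ?thesis
        using annihilator_lincomb[OF g(1), of "\<lambda>v. [:\<iota> (u v):]"] by (simp add: eigenring_x_minus_1)
    qed
    show "g rdvd r" if "\<And>b. x_minus_1 rdvd r \<odot> [:b:]" for r
      using g(4) that by (simp add: annihilator_def)
  qed (rule g(2))
qed

text \<open>The annihilator of L is stable under right multiplication by constants, so
  \<open>two_sided_const\<close> at the leading coefficient of its generator \<open>g\<close> gives
  \<sigma>^n = id. Conversely, if \<sigma>^d = id with d > 0, then x^d - 1 kills L and is a multiple
  of g, so n \<le> d.\<close>

lemma pow_\<sigma>_eq_id_iff: "\<sigma> ^^ i = id \<longleftrightarrow> n dvd i"
proof -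
  obtain g where g: "degree g = n" "g \<noteq> 0" "\<And>b. x_minus_1 rdvd g \<odot> [:b:]"
    and gen: "\<And>r. (\<And>b. x_minus_1 rdvd r \<odot> [:b:]) \<Longrightarrow> g rdvd r"
    using annihilator_of_L by blast
  \<comment> \<open>If g = g' x, then g' kills \<sigma>(L), which is all of L because \<sigma> is
    surjective; but its degree is smaller than that of g.\<close>
  have g0: "coeff g 0 \<noteq> 0"
  proof
    assume "coeff g 0 = 0"
    then obtain g' where g': "g = pCons 0 g'" by (cases g) auto
    then have "g' \<noteq> 0" using g(2) by auto
    have "x_minus_1 rdvd g' \<odot> [:b:]" for b
    proof -
      obtain b' where b: "b = \<sigma> b'" using bij_is_surj[OF bij_\<sigma>] unfolding surj_def by blast
      have "[:0, 1:] \<odot> [:b':] = [:b:] \<odot> [:0, 1:]" unfolding b x_skew_mult_const skew_mult_x ..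
      moreover have "g = g' \<odot> [:0, 1:]" by (simp only: g' skew_mult_x)
      ultimately have "g \<odot> [:b':] = g' \<odot> [:b:] \<odot> [:0, 1:]" by (simp only: skew_mult_assoc)
      moreover have "[:0, 1:] = x_minus_1 + 1" by (simp add: x_minus_1_def one_pCons)
      ultimately have "g \<odot> [:b':] - g' \<odot> [:b:] = g' \<odot> [:b:] \<odot> x_minus_1"
        by (simp only: skew_mult_add skew_mult_1 add_diff_cancel_right')
      then have "x_minus_1 rdvd g \<odot> [:b':] - g' \<odot> [:b:]" by simp
      then show ?thesis using rdvd_diff_iff g(3) by blast
    qed
    then have "degree g \<le> degree g'" using gen rdvd_degree \<open>g' \<noteq> 0\<close> by blast
    then show False using g' \<open>g' \<noteq> 0\<close> by simp
  qed
  have "(\<sigma> ^^ n) b = b" for b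
  proof (rule two_sided_const[OF g0])
    show "g rdvd g \<odot> [:b:]"
      by (rule gen) (simp add: skew_mult_assoc const_skew_mult_const g(3))
    show "coeff g n \<noteq> 0" using g(1,2) by auto
  qed
  then have \<sigma>n: "\<sigma> ^^ n = id" by auto
  have min: "n \<le> d" if "0 < d" "\<sigma> ^^ d = id" for d
  proof -
    let ?r = "monom 1 d - 1 :: 'l poly"
    have "coeff ?r d = 1" using that by simp
    then have "?r \<noteq> 0" by force
    have "x_minus_1 rdvd ?r \<odot> [:b:]" for b
    proof -
      have "?r \<odot> [:b:] = monom b d - [:b:]"
        using monom_skew_monom[of 1 d b 0] that by (simp add: diff_skew_mult monom_0)
      then show ?thesis using x_minus_1_rdvd_monom by simp
    qed
    then have "n \<le> degree ?r" using gen rdvd_degree \<open>?r \<noteq> 0\<close> g(1) by blast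
    also have "\<dots> \<le> d" by (rule degree_diff_le) (simp_all add: degree_monom_eq)
    finally show ?thesis .
  qed
  have "\<sigma> ^^ i = \<sigma> ^^ (i mod n) \<circ> (\<sigma> ^^ n) ^^ (i div n)"
    by (simp add: funpow_mult flip: funpow_add)
  then have "\<sigma> ^^ i = \<sigma> ^^ (i mod n)" by (simp add: \<sigma>n)
  moreover have "i mod n = 0" if "\<sigma> ^^ (i mod n) = id"
    using min[OF _ that] mod_less_divisor[OF n_pos, of i] by (meson gr0I not_le)
  moreover have "\<sigma> ^^ (i mod n) = id" if "i mod n = 0" unfolding that by auto
  ultimately show ?thesis unfolding dvd_eq_mod_eq_0 by metis
qed

lemma pow_\<sigma>_cong: "i mod n = j mod n \<Longrightarrow> \<sigma> ^^ i = \<sigma> ^^ j"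
proof -
  have "\<sigma> ^^ i = \<sigma> ^^ (i mod n) \<circ> \<sigma> ^^ (n * (i div n))" for i by (simp flip: funpow_add)
  then show "i mod n = j mod n \<Longrightarrow> \<sigma> ^^ i = \<sigma> ^^ j"
    using pow_\<sigma>_eq_id_iff by (metis dvd_triv_left comp_id)
qed

lemma galois_group_carrier: "carrier (galois_group \<iota>) = (\<lambda>i. \<sigma> ^^ i) ` {..<n}"
proof
  have *: "\<sigma> ^^ i \<in> (\<lambda>i. \<sigma> ^^ i) ` {..<n}" for i
    using pow_\<sigma>_cong[of i "i mod n"] n_pos by (intro image_eqI[of _ _ "i mod n"]) auto
  show "carrier (galois_group \<iota>) \<subseteq> (\<lambda>i. \<sigma> ^^ i) ` {..<n}"
  proof
    fix \<tau> assume "\<tau> \<in> carrier (galois_group \<iota>)"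
    then have "\<exists>i. \<tau> = \<sigma> ^^ i"
    proof (induction rule: galois_group_induct)
      case id
      show ?case by (intro exI[of _ 0]) auto
    next
      case \<sigma>
      show ?case by (intro exI[of _ 1]) auto
    next
      case (inv \<rho>)
      have "\<sigma> \<circ> \<sigma> ^^ (n - 1) = id"
        using pow_\<sigma>_eq_id_iff[of n] n_pos by (cases n) auto
      then have "\<rho> = \<sigma> ^^ (n - 1)" using inv by (metis comp_assoc comp_id id_comp)
      then show ?case by blast
    next
      case (comp \<rho> \<tau>)
      then show ?case by (metis funpow_add)
    qed
    then show "\<tau> \<in> (\<lambda>i. \<sigma> ^^ i) ` {..<n}" using * by blast
  qed
qed (use pow_\<sigma>_carrier in blast)

lemma field_norm_eq: "field_norm \<iota> x = (\<Prod>i<n. (\<sigma> ^^ i) x)"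
proof -
  have "inj_on (\<lambda>i. \<sigma> ^^ i) {..<n}"
  proof (rule linorder_inj_onI)
    fix i j assume ij: "i < j" "i \<in> {..<n}" "j \<in> {..<n}"
    show "\<sigma> ^^ i \<noteq> \<sigma> ^^ j"
    proof
      assume eq: "\<sigma> ^^ i = \<sigma> ^^ j"
      have "(\<sigma> ^^ i) ((\<sigma> ^^ (j - i)) x) = (\<sigma> ^^ i) x" for x
        using ij fun_cong[OF eq, of x] funpow_add[of i "j - i" \<sigma>] by simp
      then have "\<sigma> ^^ (j - i) = id" using inj_pow[of i] by (auto simp: inj_def)
      then show False using pow_\<sigma>_eq_id_iff[of "j - i"] ij by (auto dest: dvd_imp_le)
    qed
  qed auto
  then show ?thesis unfolding field_norm_def galois_group_carrier by (simp add: prod.reindex)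
qed

subsection \<open>The centre\<close>

abbreviation at_xn :: "'k poly \<Rightarrow> 'l poly" where
  "at_xn \<equiv> at_x_power \<iota> n"

lemma coeff_at_xn: "coeff (at_xn H) k = (if n dvd k then \<iota> (coeff H (k div n)) else 0)"
proof -
  have "coeff (at_xn H) k = (\<Sum>i\<le>degree H. if n * i = k then \<iota> (coeff H i) else 0)"
    by (simp add: at_x_power_def coeff_sum)
  also have "\<dots> = (if n dvd k then \<iota> (coeff H (k div n)) else 0)"
  proof (cases "n dvd k \<and> k div n \<le> degree H")
    case True
    have "(\<Sum>i\<le>degree H. if n * i = k then \<iota> (coeff H i) else 0)
        = (\<Sum>i\<in>{k div n}. if n * i = k then \<iota> (coeff H i) else 0)"
      by (rule sum.mono_neutral_right) (use True n_pos in auto)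
    then show ?thesis using True by simp
  next
    case False
    have "(\<Sum>i\<le>degree H. if n * i = k then \<iota> (coeff H i) else 0) = 0"
      by (rule sum.neutral) (use False n_pos in auto)
    then show ?thesis using False by (auto simp: coeff_eq_0)
  qed
  finally show ?thesis .
qed

lemma at_xn_0 [simp]: "at_xn 0 = 0"
  by (simp add: poly_eq_iff coeff_at_xn)

lemma at_xn_1 [simp]: "at_xn 1 = 1"
  by (simp add: at_x_power_def monom_0 one_pCons)

lemma at_xn_add: "at_xn (p + q) = at_xn p + at_xn q"
  by (simp add: poly_eq_iff coeff_at_xn \<iota>_add)

lemma at_xn_sum: "at_xn (sum g A) = (\<Sum>a\<in>A. at_xn (g a))"
  by (induction A rule: infinite_finite_induct) (simp_all add: at_xn_add)

lemma at_xn_monom: "at_xn (monom c i) = monom (\<iota> c) (n * i)"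
  using n_pos by (auto simp: poly_eq_iff coeff_at_xn) (metis dvd_triv_left)

lemma at_xn_mult: "at_xn (p * q) = at_xn p * at_xn q"
proof -
  have 1: "at_xn (monom a i * monom b j) = at_xn (monom a i) * at_xn (monom b j)" for a b i j
    by (simp add: mult_monom at_xn_monom \<iota>_mult distrib_left)
  have 2: "at_xn (monom a i * q) = at_xn (monom a i) * at_xn q" for a i
    by (subst (1 2) poly_as_sum_of_monoms[of q, symmetric])
       (simp only: sum_distrib_left at_xn_sum 1)
  show ?thesis
    by (subst (1 2) poly_as_sum_of_monoms[of p, symmetric])
       (simp only: sum_distrib_right at_xn_sum 2)
qed

lemma at_xn_power: "at_xn (p ^ k) = at_xn p ^ k"
  by (induction k) (simp_all add: at_xn_mult)

lemma at_xn_eq_iff: "at_xn p = at_xn q \<longleftrightarrow> p = q"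
proof
  assume eq: "at_xn p = at_xn q"
  have "coeff p k = coeff q k" for k
    using arg_cong[OF eq, of "\<lambda>p. coeff p (n * k)"] n_pos inj_\<iota>
    by (simp add: coeff_at_xn inj_eq)
  then show "p = q" by (simp add: poly_eq_iff)
qed simp

lemma at_xn_eq_0_iff [simp]: "at_xn p = 0 \<longleftrightarrow> p = 0"
  using at_xn_eq_iff[of p 0] by simp

lemma degree_at_xn: "degree (at_xn H) = n * degree H"
proof (cases "H = 0")
  case False
  show ?thesis
  proof (rule antisym)
    show "degree (at_xn H) \<le> n * degree H"
      using n_pos by (intro degree_le) (auto simp: coeff_at_xn intro!: coeff_eq_0)
    show "n * degree H \<le> degree (at_xn H)"
      using n_pos False by (intro le_degree) (simp add: coeff_at_xn)
  qed
qed simp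

text \<open>Coefficients from K are fixed by \<sigma>, and at exponents divisible by n the power of
  \<sigma> is the identity. So on either side the skew product with \<open>at_xn H\<close> is the
  commutative product of \<open>poly\<close>, where the centre can be computed.\<close>

lemma skew_mult_at_xn: "p \<odot> at_xn H = p * at_xn H"
  by (rule skew_mult_fixed) (simp add: coeff_at_xn)

lemma at_xn_skew_mult: "at_xn H \<odot> p = at_xn H * p"
proof (rule poly_eqI)
  fix k
  have *: "coeff (at_xn H) i * (\<sigma> ^^ i) c = coeff (at_xn H) i * c" for i c
    using pow_\<sigma>_eq_id_iff[of i] by (cases "n dvd i") (simp_all add: coeff_at_xn)
  show "coeff (at_xn H \<odot> p) k = coeff (at_xn H * p) k"
    unfolding coeff_skew_mult coeff_mult * ..
qed

lemma at_xn_commute: "at_xn H \<odot> p = p \<odot> at_xn H"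
  by (simp add: skew_mult_at_xn at_xn_skew_mult)

text \<open>The two hypotheses express that \<open>h\<close> commutes with the constants and with x.
  Beyond the degree the construction relies on \<open>inv_0\<close>: the inverse of the embedding
  takes 0 to 0.\<close>

lemma in_range_at_xn:
  assumes "\<And>i. coeff h i \<noteq> 0 \<Longrightarrow> n dvd i" and "\<And>i. \<sigma> (coeff h i) = coeff h i"
  obtains H where "h = at_xn H"
proof -
  define H where "H = (\<Sum>i\<le>degree h. monom (inv_into UNIV \<iota> (coeff h (n * i))) i)"
  have inv_0: "inv_into UNIV \<iota> 0 = 0" using inv_f_f[OF inj_\<iota>, of 0] by simp
  have inv: "\<iota> (inv_into UNIV \<iota> (coeff h i)) = coeff h i" for i
    using assms(2)[of i] unfolding fixed_iff by (rule f_inv_into_f)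
  have H: "coeff H i = inv_into UNIV \<iota> (coeff h (n * i))" for i
  proof (cases "i \<le> degree h")
    case False
    then have "degree h < n * i" using n_pos by (cases n) auto
    then show ?thesis using False by (simp add: H_def coeff_sum coeff_eq_0 inv_0)
  qed (simp add: H_def coeff_sum)
  have "h = at_xn H"
    using assms(1) by (auto simp: poly_eq_iff coeff_at_xn H inv)
  then show thesis by (rule that)
qed

text \<open>As u v is central, v (u v) = (u v) v, and v cancels. Left divisors of F(x^n) are thus
  right divisors with the same cofactor.\<close>

lemma mult_eq_at_xn_commute:
  assumes "u \<odot> v = at_xn H" "H \<noteq> 0"
  shows "v \<odot> u = at_xn H"
proof (rule skew_mult_right_cancel)
  show "v \<odot> u \<odot> v = at_xn H \<odot> v" by (simp add: skew_mult_assoc assms at_xn_commute)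
  show "v \<noteq> 0" using assms by auto
qed

end

section \<open>Right divisors of \<open>F(x\<^sup>n)\<close>\<close>

locale central_factor = cyclic_extension +
  fixes F :: "'a poly"
  assumes F_irreducible: "irreducible F" and F_0: "coeff F 0 \<noteq> 0"
begin

lemma F_nonzero: "F \<noteq> 0"
  using F_0 by auto

lemma annihilates_F: "f rdvd at_xn F \<Longrightarrow> annihilates f (at_xn F)"
  unfolding annihilates_def at_xn_commute by (simp add: rdvd_mult)

text \<open>Made monic, \<open>g\<close> has a nonzero constant coefficient because it divides
  F(x^n), and it generates a two-sided ideal; so it is G(x^n) with G in K[y]. Then G divides F, and
  it is no unit because f divides G(x^n); so it is an associate of F.\<close>

lemma annihilator_eq:
  assumes irr: "skew_irreducible \<sigma> f" and f: "f rdvd at_xn F"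
    and g: "annihilates f g" "g \<noteq> 0" and gen: "\<And>r. annihilates f r \<Longrightarrow> g rdvd r"
  shows "degree g = n * degree F" and "at_xn F rdvd g"
proof -
  define h where "h = [:inverse (lead_coeff g):] \<odot> g"
  have h0: "h \<noteq> 0" and lh: "lead_coeff h = 1"
    using g(2) by (simp_all add: h_def skew_mult_const)
  have gh: "g = [:lead_coeff g:] \<odot> h" using g(2) by (simp add: h_def skew_mult_const)
  have ann: "annihilates f h"
    using g(1) unfolding annihilates_def h_def by (simp add: skew_mult_assoc rdvd_mult)
  have genh: "h rdvd r" if r: "annihilates f r" for r
  proof -
    obtain q where "r = q \<odot> g" using gen[OF r] unfolding skew_right_dvd_def by blast
    then have "r = q \<odot> [:lead_coeff g:] \<odot> h" using gh by (simp add: skew_mult_assoc)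
    then show ?thesis by simp
  qed
  have two_sided: "h rdvd h \<odot> b" for b
    using ann by (intro genh) (simp add: annihilates_def skew_mult_assoc)
  obtain q where q: "at_xn F = q \<odot> h"
    using genh[OF annihilates_F[OF f]] unfolding skew_right_dvd_def by blast
  have "coeff (at_xn F) 0 \<noteq> 0" using F_0 by (simp add: coeff_at_xn)
  then have c0: "coeff h 0 \<noteq> 0" unfolding q coeff_skew_mult_0 by auto
  have "n dvd i" if "coeff h i \<noteq> 0" for i
    using two_sided_const[OF c0 two_sided that] unfolding pow_\<sigma>_eq_id_iff[symmetric] by auto
  then obtain G where G: "h = at_xn G"
    using in_range_at_xn[of h] two_sided_x[OF c0 two_sided lh] by blast
  have "G \<noteq> 0" using G h0 by auto
  \<comment> \<open>This turns divisibility in R into divisibility in K[y]: S(x^n) is a left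
    multiple of h, and its degree n deg S is too small unless S = 0.\<close>
  define S where "S = F mod G"
  have "at_xn F = at_xn (F div G) \<odot> h + at_xn S"
    unfolding G skew_mult_at_xn S_def by (simp flip: at_xn_mult at_xn_add)
  then have "at_xn S = (q - at_xn (F div G)) \<odot> h" using q by (simp add: diff_skew_mult)
  then have "h rdvd at_xn S" by simp
  then have "S = 0 \<or> degree G \<le> degree S"
    using rdvd_degree[of h "at_xn S"] n_pos by (auto simp: G degree_at_xn)
  then have "S = 0" using degree_mod_less[OF \<open>G \<noteq> 0\<close>, of F] by (auto simp: S_def)
  then have "G dvd F" unfolding S_def by (simp add: mod_eq_0_iff_dvd)
  moreover have "\<not> is_unit G"
  proof
    assume "is_unit G"
    then have "degree h = 0" unfolding G degree_at_xn by (simp add: is_unit_iff_degree \<open>G \<noteq> 0\<close>)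
    moreover have "f rdvd h" using ann unfolding annihilates_def by (metis skew_mult_1(2))
    ultimately show False using rdvd_degree[of f h] skew_irreducible_degree[OF irr] h0 by simp
  qed
  ultimately have FG: "F dvd G" using irreducibleD'[OF F_irreducible] by blast
  have "degree F = degree G"
    using dvd_imp_degree_le[OF FG \<open>G \<noteq> 0\<close>] dvd_imp_degree_le[OF \<open>G dvd F\<close> F_nonzero] by simp
  moreover have "degree g = degree h" using g(2) by (simp add: h_def skew_mult_const)
  ultimately show "degree g = n * degree F" by (simp add: G degree_at_xn)
  obtain H where "G = H * F" using FG by (metis dvd_def mult.commute)
  then have "h = at_xn H \<odot> at_xn F" by (simp add: G at_xn_mult skew_mult_at_xn)
  then show "at_xn F rdvd g" using gh rdvd_mult[of "at_xn F" h] by (metis rdvd_self(2))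
qed

lemma annihilatesD:
  assumes irr: "skew_irreducible \<sigma> f" and f: "f rdvd at_xn F" and r: "annihilates f r"
  shows "at_xn F rdvd r"
proof -
  have p: "at_xn F \<noteq> 0" "annihilates f (at_xn F)" using F_nonzero annihilates_F[OF f] by auto
  obtain bs where bs: "eigenring_basis \<sigma> f bs" using eigenring_basis_exists[OF irr p] by blast
  obtain g where g: "annihilates f g" "g \<noteq> 0" "\<And>r. annihilates f r \<Longrightarrow> g rdvd r"
    using annihilates_generator[OF irr bs] by blast
  have "at_xn F rdvd g" by (rule annihilator_eq(2)[OF irr f g])
  moreover obtain q where "r = q \<odot> g" using g(3)[OF r] unfolding skew_right_dvd_def by blast
  ultimately show ?thesis by (simp add: rdvd_mult)
qed

text \<open>Write F(x^n) = q h = h q. Its degree being too small, q does not annihilate R/Rf, so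
  some q v has a nonzero class; h kills this class, hence deg h \<ge> deg f. By symmetry all
  irreducible right divisors have the same degree.\<close>

lemma degree_irreducible_factor_le:
  assumes irr: "skew_irreducible \<sigma> f" "skew_irreducible \<sigma> h"
    and dvd: "f rdvd at_xn F" "h rdvd at_xn F"
  shows "degree f \<le> degree h"
proof -
  obtain q where q: "at_xn F = q \<odot> h" using dvd(2) unfolding skew_right_dvd_def by blast
  have "at_xn F \<noteq> 0" using F_nonzero by simp
  then have q0: "q \<noteq> 0" and h0: "h \<noteq> 0" using q by auto
  have "degree q < degree (at_xn F)"
    using skew_irreducible_degree[OF irr(2)] by (simp add: q degree_skew_mult q0)
  then have "\<not> annihilates f q"
    using annihilatesD[OF irr(1) dvd(1)] rdvd_degree q0 by fastforce
  then obtain v where v: "\<not> f rdvd q \<odot> v" unfolding annihilates_def by blast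
  have "h \<odot> q = at_xn F" using mult_eq_at_xn_commute q F_nonzero by metis
  then have "f rdvd h \<odot> (q \<odot> v)"
    using annihilates_F[OF dvd(1)] unfolding annihilates_def by (metis skew_mult_assoc)
  then show ?thesis by (rule irreducible_annihilator_degree[OF irr(1) v h0])
qed

lemma factors_degree:
  assumes irr: "skew_irreducible \<sigma> f" and f: "f rdvd at_xn F"
    and m: "has_irreducible_factors \<sigma> (at_xn F) m"
  shows "m * degree f = n * degree F"
proof -
  obtain fs where fs: "length fs = m" "\<forall>h\<in>set fs. skew_irreducible \<sigma> h"
    "skew_prod_list \<sigma> fs = at_xn F" using m unfolding has_irreducible_factors_def by blast
  have "skew_prod_list \<sigma> gs \<noteq> 0 \<and> degree (skew_prod_list \<sigma> gs) = (\<Sum>h\<leftarrow>gs. degree h)"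
    if "\<forall>h\<in>set gs. skew_irreducible \<sigma> h" for gs
    using that
    by (induction gs) (auto simp: skew_prod_list_def degree_skew_mult dest: skew_irreducible_degree)
  then have "degree (at_xn F) = (\<Sum>h\<leftarrow>fs. degree h)" using fs by metis
  moreover have "degree h = degree f" if h: "h \<in> set fs" for h
  proof -
    obtain as bs where "fs = as @ h # bs" using split_list[OF h] by blast
    moreover have "skew_prod_list \<sigma> (as @ gs) = skew_prod_list \<sigma> as \<odot> skew_prod_list \<sigma> gs" for gs
      by (induction as) (simp_all add: skew_prod_list_def skew_mult_assoc)
    moreover have "skew_prod_list \<sigma> (h # bs) = h \<odot> skew_prod_list \<sigma> bs"
      by (simp add: skew_prod_list_def)
    \<comment> \<open>Because the product is central, the factors can be rotated until
      \<open>h\<close> stands at the right end.\<close>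
    ultimately have "skew_prod_list \<sigma> as \<odot> (h \<odot> skew_prod_list \<sigma> bs) = at_xn F"
      using fs(3) by metis
    from mult_eq_at_xn_commute[OF this F_nonzero]
    have "h \<odot> (skew_prod_list \<sigma> bs \<odot> skew_prod_list \<sigma> as) = at_xn F" by (simp add: skew_mult_assoc)
    from mult_eq_at_xn_commute[OF this F_nonzero] have "h rdvd at_xn F" by (metis rdvd_self(2))
    moreover have "skew_irreducible \<sigma> h" using fs(2) h by blast
    ultimately show ?thesis using irr f degree_irreducible_factor_le by (metis antisym)
  qed
  then have "(\<Sum>h\<leftarrow>fs. degree h) = m * degree f"
    using fs(1) by (simp add: sum_list_triv cong: map_cong)
  ultimately show ?thesis by (simp add: degree_at_xn)
qed

text \<open>The image of \<open>a\<close> on \<open>R/Rf\<close> has dimension the rank \<open>r\<close>, so it is killed by some \<open>g\<close> of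
  degree \<open>r deg f\<close>; then \<open>g a\<close> annihilates \<open>R/Rf\<close> and is a multiple of \<open>F(x\<^sup>n)\<close>.\<close>

lemma rank_bound:
  assumes irr: "skew_irreducible \<sigma> f" and f: "f rdvd at_xn F" and a: "a \<noteq> 0"
  shows "n * degree F \<le> skew_rank \<sigma> f a * degree f + degree a"
    and "skew_rank \<sigma> f a * degree f + degree a = n * degree F \<Longrightarrow> a rdvd at_xn F"
proof -
  have p: "at_xn F \<noteq> 0" "annihilates f (at_xn F)" using F_nonzero annihilates_F[OF f] by auto
  obtain g where g: "g \<noteq> 0" "degree g = skew_rank \<sigma> f a * degree f" "annihilates f (g \<odot> a)"
    using skew_rank_annihilator[OF irr p] .
  have dvd: "at_xn F rdvd g \<odot> a" by (rule annihilatesD[OF irr f g(3)])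
  have deg: "degree (g \<odot> a) = skew_rank \<sigma> f a * degree f + degree a"
    by (simp add: degree_skew_mult g a)
  show "n * degree F \<le> skew_rank \<sigma> f a * degree f + degree a"
    using rdvd_degree[OF dvd] g(1) a deg by (simp add: degree_at_xn)
  obtain c where c: "g \<odot> a = c \<odot> at_xn F" using dvd unfolding skew_right_dvd_def by blast
  have "c \<odot> at_xn F \<noteq> 0" unfolding c[symmetric] using g(1) a by simp
  then have c0: "c \<noteq> 0" by auto
  assume "skew_rank \<sigma> f a * degree f + degree a = n * degree F"
  then have "degree c = 0" using deg degree_skew_mult[OF c0 p(1)] by (simp add: c degree_at_xn)
  then have "skew_unit \<sigma> c" using c0 by (simp add: skew_unit_iff)
  then obtain c' where "c' \<odot> c = 1" unfolding skew_unit_def by blast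
  then have "at_xn F = c' \<odot> g \<odot> a" by (metis c skew_mult_assoc skew_mult_1(1))
  then show "a rdvd at_xn F" by simp
qed

end

section \<open>The reduced norm\<close>

lemma divisor_of_prime_power:
  fixes p :: "'a :: algebraic_semidom"
  assumes "prime_elem p" "a dvd p ^ k"
  shows "\<exists>u j. is_unit u \<and> a = u * p ^ j"
  using assms(2)
proof (induction k arbitrary: a)
  case 0
  then show ?case by (intro exI[of _ a] exI[of _ 0]) simp
next
  case (Suc k)
  have p0: "p \<noteq> 0" using assms(1) by auto
  show ?case
  proof (cases "p dvd a")
    case True
    then obtain b where b: "a = p * b" by blast
    then have "b dvd p ^ k" using Suc.prems p0 by simp
    from Suc.IH[OF this] obtain u j where "is_unit u" "b = u * p ^ j" by blast
    then show ?thesis using b by (intro exI[of _ u] exI[of _ "Suc j"]) (simp add: mult.left_commute)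
  next
    case False
    from Suc.prems obtain c where c: "p * p ^ k = a * c" by auto
    then have "p dvd c" using False prime_elem_dvd_multD[OF assms(1), of a c] by (metis dvd_triv_left)
    then obtain c' where "c = p * c'" by blast
    then have "p * p ^ k = p * (a * c')" using c by (simp add: mult.left_commute)
    then have "p ^ k = a * c'" using p0 by simp
    then show ?thesis using Suc.IH by simp
  qed
qed

lemma coeff_prod_top:
  fixes p :: "'i \<Rightarrow> 'a::comm_semiring_1 poly"
  assumes "finite S" "\<And>i. i \<in> S \<Longrightarrow> degree (p i) \<le> d"
  shows "degree (prod p S) \<le> d * card S \<and> coeff (prod p S) (d * card S) = (\<Prod>i\<in>S. coeff (p i) d)"
  using assms
proof (induction S rule: finite_induct)
  case (insert x S)
  have IH: "degree (prod p S) \<le> d * card S"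
    "coeff (prod p S) (d * card S) = (\<Prod>i\<in>S. coeff (p i) d)" using insert by auto
  have dx: "degree (p x) \<le> d" using insert.prems by simp
  have "coeff (p x * prod p S) (d + d * card S) = coeff (p x) d * coeff (prod p S) (d * card S)"
  proof -
    have "coeff (p x * prod p S) (d + d * card S)
        = (\<Sum>i\<in>{d}. coeff (p x) i * coeff (prod p S) (d + d * card S - i))"
      unfolding coeff_mult
    proof (rule sum.mono_neutral_right)
      show "\<forall>i\<in>{..d + d * card S} - {d}. coeff (p x) i * coeff (prod p S) (d + d * card S - i) = 0"
      proof
        fix i assume "i \<in> {..d + d * card S} - {d}"
        then have "i > degree (p x) \<or> d + d * card S - i > degree (prod p S)"
          using dx IH(1) by auto
        then show "coeff (p x) i * coeff (prod p S) (d + d * card S - i) = 0"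
          by (auto simp: coeff_eq_0)
      qed
    qed auto
    then show ?thesis by simp
  qed
  moreover have "degree (p x * prod p S) \<le> d + d * card S"
    using degree_mult_le[of "p x" "prod p S"] dx IH(1) by linarith
  ultimately show ?case using insert.hyps IH(2) by simp
qed simp

lemma coeff_det_top:
  fixes A :: "'a::comm_ring_1 poly mat"
  assumes A: "A \<in> carrier_mat n n" and deg: "\<And>i j. i < n \<Longrightarrow> j < n \<Longrightarrow> degree (A $$ (i, j)) \<le> d"
  shows "degree (det A) \<le> d * n" and "coeff (det A) (d * n) = det (map_mat (\<lambda>p. coeff p d) A)"
proof -
  have prod: "degree (\<Prod>i = 0..<n. A $$ (i, \<pi> i)) \<le> d * n
      \<and> coeff (\<Prod>i = 0..<n. A $$ (i, \<pi> i)) (d * n) = (\<Prod>i = 0..<n. coeff (A $$ (i, \<pi> i)) d)"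
    if "\<pi> permutes {0..<n}" for \<pi>
    using coeff_prod_top[of "{0..<n}" "\<lambda>i. A $$ (i, \<pi> i)" d] deg permutes_in_image[OF that] by simp
  show "degree (det A) \<le> d * n"
    unfolding det_def'[OF A]
  proof (rule degree_sum_le)
    fix \<pi> assume "\<pi> \<in> {\<pi>. \<pi> permutes {0..<n}}"
    then show "degree (signof \<pi> * (\<Prod>i = 0..<n. A $$ (i, \<pi> i))) \<le> d * n"
      using prod[of \<pi>] by (auto simp: sign_def)
  qed (simp add: finite_permutations)
  have A': "map_mat (\<lambda>p. coeff p d) A \<in> carrier_mat n n" using A by simp
  show "coeff (det A) (d * n) = det (map_mat (\<lambda>p. coeff p d) A)"
    unfolding det_def'[OF A] det_def'[OF A'] coeff_sum
  proof (rule sum.cong[OF refl])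
    fix \<pi> assume "\<pi> \<in> {\<pi>. \<pi> permutes {0..<n}}"
    then have \<pi>: "\<pi> permutes {0..<n}" by simp
    have "(\<Prod>i = 0..<n. map_mat (\<lambda>p. coeff p d) A $$ (i, \<pi> i)) = (\<Prod>i = 0..<n. coeff (A $$ (i, \<pi> i)) d)"
      by (rule prod.cong) (use A permutes_in_image[OF \<pi>] in auto)
    then show "coeff (signof \<pi> * (\<Prod>i = 0..<n. A $$ (i, \<pi> i))) (d * n)
        = signof \<pi> * (\<Prod>i = 0..<n. map_mat (\<lambda>p. coeff p d) A $$ (i, \<pi> i))"
      using prod[OF \<pi>] by (auto simp: sign_def)
  qed
qed

text \<open>A grading by residues modulo n. The shift \<open>r\<close> is an integer because it will
  be a difference \<pi>(i) - i, which may be negative.\<close>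

definition supported_mod :: "nat \<Rightarrow> int \<Rightarrow> 'a::comm_semiring_1 poly \<Rightarrow> bool" where
  "supported_mod n r p \<longleftrightarrow> (\<forall>j. coeff p j \<noteq> 0 \<longrightarrow> int n dvd int j - r)"

lemma supported_mod_mult:
  assumes "supported_mod n r p" "supported_mod n s q"
  shows "supported_mod n (r + s) (p * q)"
  unfolding supported_mod_def
proof (intro allI impI)
  fix j assume "coeff (p * q) j \<noteq> 0"
  then obtain i where i: "i \<le> j" "coeff p i * coeff q (j - i) \<noteq> 0"
    unfolding coeff_mult by (metis (no_types, lifting) atMost_iff sum.neutral)
  then have "coeff p i \<noteq> 0" "coeff q (j - i) \<noteq> 0" by auto
  then have "int n dvd (int i - r) + (int (j - i) - s)"
    using assms unfolding supported_mod_def by (intro dvd_add) auto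
  then show "int n dvd int j - (r + s)" using i by (simp add: of_nat_diff algebra_simps)
qed

lemma supported_mod_prod:
  assumes "finite S" "\<And>i. i \<in> S \<Longrightarrow> supported_mod n (r i) (p i)"
  shows "supported_mod n (sum r S) (prod p S)"
  using assms
  by (induction S rule: finite_induct) (auto simp: supported_mod_mult, simp add: supported_mod_def)

lemma supported_mod_sum:
  "(\<And>i. i \<in> S \<Longrightarrow> supported_mod n r (p i)) \<Longrightarrow> supported_mod n r (sum p S)"
  unfolding supported_mod_def coeff_sum by (meson sum.not_neutral_contains_not_neutral)

context cyclic_extension
begin

text \<open>Right multiplication by \<open>p\<close> on the free left \<open>L[x\<^sup>n]\<close>-module \<open>R\<close> with basis
  \<open>1, x, \<dots>, x\<^sup>n\<^sup>-\<^sup>1\<close>, rescaled by the powers of a commuting variable \<open>z\<close> with \<open>z\<^sup>n = x\<^sup>n\<close>,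
  so that \<open>x\<close> becomes \<open>z\<close> times the cyclic shift.\<close>

definition norm_mat :: "'l poly \<Rightarrow> 'l poly mat" where
  "norm_mat p = mat n n (\<lambda>(i, c).
     \<Sum>j\<le>degree p. if (i + j) mod n = c then monom ((\<sigma> ^^ i) (coeff p j)) j else 0)"

text \<open>The rescaling is conjugation by a diagonal matrix of powers of z, so the determinant is
  that of right multiplication by \<open>p\<close>. Its benefit is that \<open>coeff p j\<close>
  sits at exponent j in every row, which exposes the constant and leading coefficients.\<close>

definition reduced_norm :: "'l poly \<Rightarrow> 'l poly" where
  "reduced_norm p = det (norm_mat p)"

lemma norm_mat_carrier [simp]: "norm_mat p \<in> carrier_mat n n"
  by (simp add: norm_mat_def)

lemma norm_mat_dim [simp]: "dim_row (norm_mat p) = n" "dim_col (norm_mat p) = n"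
  by (simp_all add: norm_mat_def)

lemma coeff_norm_mat:
  assumes "i < n" "c < n"
  shows "coeff (norm_mat p $$ (i, c)) j = (if (i + j) mod n = c then (\<sigma> ^^ i) (coeff p j) else 0)"
proof -
  have "coeff (norm_mat p $$ (i, c)) j
      = (\<Sum>k\<le>degree p. coeff (if (i + k) mod n = c then monom ((\<sigma> ^^ i) (coeff p k)) k else 0) j)"
    using assms by (simp add: norm_mat_def coeff_sum)
  also have "\<dots>
      = (\<Sum>k\<le>degree p. if k = j then (if (i + k) mod n = c then (\<sigma> ^^ i) (coeff p k) else 0) else 0)"
    by (rule sum.cong) auto
  finally have "coeff (norm_mat p $$ (i, c)) j
      = (\<Sum>k\<le>degree p. if k = j then (if (i + k) mod n = c then (\<sigma> ^^ i) (coeff p k) else 0) else 0)" .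
  then show ?thesis by (auto simp: coeff_eq_0)
qed

text \<open>In the sum over the intermediate index \<open>e\<close> only e = (i + j) mod n
  contributes, and there \<sigma>^e is the composite of \<sigma>^i and \<sigma>^j because \<sigma>^n
  = id.\<close>

lemma norm_mat_mult: "norm_mat (p \<odot> q) = norm_mat p * norm_mat q"
proof (rule eq_matI)
  fix i c assume "i < dim_row (norm_mat p * norm_mat q)" "c < dim_col (norm_mat p * norm_mat q)"
  then have ic: "i < n" "c < n" by auto
  show "norm_mat (p \<odot> q) $$ (i, c) = (norm_mat p * norm_mat q) $$ (i, c)"
  proof (rule poly_eqI)
    fix t
    have "coeff ((norm_mat p * norm_mat q) $$ (i, c)) t
      = (\<Sum>e<n. \<Sum>j\<le>t. coeff (norm_mat p $$ (i, e)) j * coeff (norm_mat q $$ (e, c)) (t - j))"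
      using ic by (simp add: times_mat_def scalar_prod_def coeff_sum coeff_mult atLeast0LessThan)
    also have "\<dots> = (\<Sum>j\<le>t. \<Sum>e<n. if e = (i + j) mod n
        then (if (e + (t - j)) mod n = c then (\<sigma> ^^ i) (coeff p j) * (\<sigma> ^^ e) (coeff q (t - j)) else 0)
        else 0)"
      by (subst sum.swap) (auto intro!: sum.cong simp: coeff_norm_mat ic)
    also have "\<dots> = (\<Sum>j\<le>t. if (i + t) mod n = c
        then (\<sigma> ^^ i) (coeff p j * (\<sigma> ^^ j) (coeff q (t - j))) else 0)"
    proof (rule sum.cong[OF refl])
      fix j assume "j \<in> {..t}"
      then have "(i + j) + (t - j) = i + t" by simp
      then have jt: "((i + j) mod n + (t - j)) mod n = (i + t) mod n" by (metis mod_add_left_eq)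
      have delta: "(\<Sum>e<n. if e = (i + j) mod n then h e else 0) = h ((i + j) mod n)"
        for h :: "nat \<Rightarrow> 'l" using n_pos by simp
      have "\<sigma> ^^ ((i + j) mod n) = \<sigma> ^^ i \<circ> \<sigma> ^^ j"
        using pow_\<sigma>_cong[of "(i + j) mod n" "i + j"] by (simp add: funpow_add)
      then show "(\<Sum>e<n. if e = (i + j) mod n
          then (if (e + (t - j)) mod n = c then (\<sigma> ^^ i) (coeff p j) * (\<sigma> ^^ e) (coeff q (t - j)) else 0)
          else 0) = (if (i + t) mod n = c
          then (\<sigma> ^^ i) (coeff p j * (\<sigma> ^^ j) (coeff q (t - j))) else 0)"
        by (simp only: delta jt comp_apply pow_mult)
    qed
    also have "\<dots> = coeff (norm_mat (p \<odot> q) $$ (i, c)) t"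
      by (simp add: coeff_norm_mat ic coeff_skew_mult pow_sum)
    finally show "coeff (norm_mat (p \<odot> q) $$ (i, c)) t = coeff ((norm_mat p * norm_mat q) $$ (i, c)) t"
      by simp
  qed
qed auto

lemma reduced_norm_mult: "reduced_norm (p \<odot> q) = reduced_norm p * reduced_norm q"
  unfolding reduced_norm_def norm_mat_mult by (rule det_mult[OF norm_mat_carrier norm_mat_carrier])

text \<open>The exponent 0 occurs only on the diagonal, so the constant terms form a diagonal matrix
  with the conjugates of \<open>coeff p 0\<close>.\<close>

lemma coeff_0_reduced_norm: "coeff (reduced_norm p) 0 = field_norm \<iota> (coeff p 0)"
proof -
  interpret ev: comm_ring_hom "\<lambda>p :: 'l poly. coeff p 0"
    by unfold_locales (simp_all add: coeff_mult_0)
  let ?A = "map_mat (\<lambda>p. coeff p 0) (norm_mat p)"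
  have A: "?A \<in> carrier_mat n n" by simp
  have entry: "?A $$ (i, c) = (if i = c then (\<sigma> ^^ i) (coeff p 0) else 0)" if "i < n" "c < n" for i c
    using that by (simp add: coeff_norm_mat)
  have "coeff (reduced_norm p) 0 = det ?A"
    unfolding reduced_norm_def by (rule ev.hom_det[symmetric])
  also have "\<dots> = prod_list (diag_mat ?A)"
    by (rule det_upper_triangular[OF _ A]) (auto intro!: upper_triangularI simp: coeff_norm_mat)
  also have "\<dots> = (\<Prod>i<n. (\<sigma> ^^ i) (coeff p 0))"
    unfolding prod_list_diag_prod using entry by (simp add: atLeast0LessThan)
  finally show ?thesis by (simp add: field_norm_eq)
qed

lemma reduced_norm_const: "reduced_norm [:c:] = [:field_norm \<iota> c:]"
proof -
  have deg: "degree (norm_mat [:c:] $$ (i, j)) \<le> 0" if "i < n" "j < n" for i j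
    by (rule degree_le) (use that in \<open>auto simp: coeff_norm_mat coeff_pCons split: nat.split\<close>)
  have "degree (reduced_norm [:c:]) \<le> 0 * n"
    unfolding reduced_norm_def by (rule coeff_det_top(1)[OF norm_mat_carrier deg])
  then show ?thesis using coeff_0_reduced_norm[of "[:c:]"]
    by (auto elim!: degree_eq_zeroE)
qed

text \<open>The matrix is z times the cyclic shift. The only nonzero entry of its last row is in
  column 0; deleting that row and column leaves z times the identity, and the position contributes
  the sign.\<close>

lemma reduced_norm_x: "reduced_norm [:0, 1:] = monom ((- 1) ^ (n - 1)) n"
proof -
  define k where "k = n - 1"
  then have k: "k < n" "Suc k = n" "n - Suc 0 = k" using n_pos by auto
  let ?A = "norm_mat [:0, 1:]"
  have entry: "?A $$ (i, c) = (if (i + 1) mod n = c then monom 1 1 else 0)" if "i < n" "c < n" for i c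
    by (rule poly_eqI) (use that in \<open>auto simp: coeff_norm_mat coeff_pCons split: nat.split\<close>)
  have "mat_delete ?A k 0 = monom 1 1 \<cdot>\<^sub>m 1\<^sub>m k"
  proof (rule eq_matI)
    fix i j assume "i < dim_row (monom 1 1 \<cdot>\<^sub>m 1\<^sub>m k :: 'l poly mat)"
      "j < dim_col (monom 1 1 \<cdot>\<^sub>m 1\<^sub>m k :: 'l poly mat)"
    then have ij: "i < k" "j < k" "i < n" "Suc i < n" "Suc j < n" using k by auto
    then show "mat_delete ?A k 0 $$ (i, j) = (monom 1 1 \<cdot>\<^sub>m 1\<^sub>m k) $$ (i, j)"
      by (simp add: mat_delete_def entry k(3))
  qed (simp_all add: mat_delete_def k(3))
  then have "det (mat_delete ?A k 0) = monom 1 k" by (simp add: monom_power)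
  then have cof: "cofactor ?A k 0 = (- 1) ^ k * monom 1 k" by (simp add: cofactor_def)
  have "det ?A = (\<Sum>j<n. ?A $$ (k, j) * cofactor ?A k j)"
    by (rule laplace_expansion_row) (simp_all add: k)
  also have "\<dots> = (\<Sum>j\<in>{0}. ?A $$ (k, j) * cofactor ?A k j)"
    by (rule sum.mono_neutral_right) (use n_pos in \<open>auto simp: entry k\<close>)
  also have "\<dots> = monom 1 1 * ((- 1) ^ k * monom 1 k)" using n_pos by (simp add: cof entry k)
  also have "\<dots> = monom ((- 1) ^ (n - 1)) n"
    using k by (cases "even k") (simp_all add: mult_monom minus_monom)
  finally show ?thesis by (simp add: reduced_norm_def)
qed

lemma reduced_norm_monom:
  "reduced_norm (monom c d) = monom (field_norm \<iota> c * ((- 1) ^ (n - 1)) ^ d) (d * n)"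
proof (induction d)
  case 0
  then show ?case by (simp add: monom_0 reduced_norm_const)
next
  case (Suc d)
  have "monom c (Suc d) = monom c d \<odot> [:0, 1:]" by (simp add: skew_mult_x monom_Suc)
  then show ?case by (simp add: reduced_norm_mult reduced_norm_x Suc mult_monom algebra_simps)
qed

lemma degree_norm_mat: "i < n \<Longrightarrow> c < n \<Longrightarrow> degree (norm_mat p $$ (i, c)) \<le> degree p"
  by (rule degree_le) (simp add: coeff_norm_mat coeff_eq_0)

text \<open>The top coefficient of the determinant sees only the coefficients of the entries at deg
  p, hence only the leading term of \<open>p\<close>; for a monomial the norm is known by
  multiplicativity.\<close>

lemma reduced_norm_top:
  shows "degree (reduced_norm p) \<le> degree p * n"
    and "coeff (reduced_norm p) (degree p * n)
      = field_norm \<iota> (lead_coeff p) * ((- 1) ^ (n - 1)) ^ degree p"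
proof -
  let ?m = "monom (lead_coeff p) (degree p)" and ?d = "degree p"
  show "degree (reduced_norm p) \<le> ?d * n"
    unfolding reduced_norm_def by (rule coeff_det_top(1)[OF norm_mat_carrier degree_norm_mat])
  have degm: "degree (norm_mat ?m $$ (i, c)) \<le> ?d" if "i < n" "c < n" for i c
    using degree_norm_mat[OF that, of ?m] degree_monom_le le_trans by blast
  have "map_mat (\<lambda>q. coeff q ?d) (norm_mat p) = map_mat (\<lambda>q. coeff q ?d) (norm_mat ?m)"
    by (rule eq_matI) (simp_all add: coeff_norm_mat)
  then have "coeff (reduced_norm p) (?d * n) = coeff (reduced_norm ?m) (?d * n)"
    unfolding reduced_norm_def
    by (simp only: coeff_det_top(2)[OF norm_mat_carrier degree_norm_mat]
        coeff_det_top(2)[OF norm_mat_carrier degm])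
  then show "coeff (reduced_norm p) (?d * n) = field_norm \<iota> (lead_coeff p) * ((- 1) ^ (n - 1)) ^ ?d"
    by (simp add: reduced_norm_monom)
qed

lemma field_norm_eq_0_iff: "field_norm \<iota> x = 0 \<longleftrightarrow> x = 0"
  using n_pos by (auto simp: field_norm_eq)

lemma degree_reduced_norm: "p \<noteq> 0 \<Longrightarrow> degree (reduced_norm p) = degree p * n"
  by (rule antisym[OF reduced_norm_top(1) le_degree])
     (simp add: reduced_norm_top(2) field_norm_eq_0_iff)

text \<open>Let \<sigma> act on coefficients and write N for the norm. In x p = \<sigma>(p) x the
  nonzero factor N(x) cancels after taking norms, so N(p) = N(\<sigma>(p)); and N commutes with
  \<sigma> because determinants do.\<close>

lemma reduced_norm_fixed: "\<sigma> (coeff (reduced_norm p) k) = coeff (reduced_norm p) k"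
proof -
  let ?s = "map_poly \<sigma>"
  have add: "\<sigma> (x + y) = \<sigma> x + \<sigma> y" and mult: "\<sigma> (x * y) = \<sigma> x * \<sigma> y" for x y
    using pow_add[of 1] pow_mult[of 1] by simp_all
  have sum: "\<sigma> (sum g A) = (\<Sum>a\<in>A. \<sigma> (g a))" for g and A :: "nat set"
    using pow_sum[of 1 g A] by simp
  interpret s: comm_ring_hom ?s
    by unfold_locales (simp_all add: poly_eq_iff coeff_map_poly coeff_mult add mult sum)
  have "norm_mat (?s p) = map_mat ?s (norm_mat p)"
  proof (rule eq_matI)
    fix i c assume "i < dim_row (map_mat ?s (norm_mat p))" "c < dim_col (map_mat ?s (norm_mat p))"
    then show "norm_mat (?s p) $$ (i, c) = map_mat ?s (norm_mat p) $$ (i, c)"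
      by (auto intro!: poly_eqI simp: coeff_norm_mat coeff_map_poly funpow_swap1)
  qed simp_all
  then have "reduced_norm (?s p) = ?s (reduced_norm p)" by (simp add: reduced_norm_def)
  moreover have "[:0, 1:] \<odot> p = ?s p \<odot> [:0, 1:]"
  proof (rule poly_eqI)
    fix k show "coeff ([:0, 1:] \<odot> p) k = coeff (?s p \<odot> [:0, 1:]) k"
      by (cases k) (simp_all add: coeff_skew_mult_0 coeff_linear_skew_mult skew_mult_x coeff_map_poly)
  qed
  then have "reduced_norm [:0, 1:] * reduced_norm p = reduced_norm [:0, 1:] * reduced_norm (?s p)"
    by (metis reduced_norm_mult mult.commute)
  then have "reduced_norm p = reduced_norm (?s p)"
    by (simp add: reduced_norm_x)
  ultimately have "reduced_norm p = ?s (reduced_norm p)" by simp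
  then show ?thesis by (metis coeff_map_poly \<sigma>_simps(1))
qed

text \<open>Entry (i, c) involves only exponents congruent to c - i modulo n, and these differences
  add up to 0 along any permutation.\<close>

lemma reduced_norm_supported: "coeff (reduced_norm p) k \<noteq> 0 \<Longrightarrow> n dvd k"
proof -
  have "supported_mod n 0 (reduced_norm p)"
    unfolding reduced_norm_def det_def'[OF norm_mat_carrier]
  proof (rule supported_mod_sum)
    fix \<pi> assume "\<pi> \<in> {\<pi>. \<pi> permutes {0..<n}}"
    then have \<pi>: "\<pi> permutes {0..<n}" by simp
    have "supported_mod n (\<Sum>i = 0..<n. int (\<pi> i) - int i) (\<Prod>i = 0..<n. norm_mat p $$ (i, \<pi> i))"
    proof (rule supported_mod_prod)
      fix i assume "i \<in> {0..<n}"
      then have i: "i < n" "\<pi> i < n" using permutes_in_image[OF \<pi>, of i] by auto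
      show "supported_mod n (int (\<pi> i) - int i) (norm_mat p $$ (i, \<pi> i))"
        unfolding supported_mod_def
      proof (intro allI impI)
        fix j assume "coeff (norm_mat p $$ (i, \<pi> i)) j \<noteq> 0"
        then have "\<pi> i = (i + j) mod n" using i by (auto simp: coeff_norm_mat split: if_splits)
        then have "int (\<pi> i) = (int i + int j) mod int n" by (simp add: zmod_int)
        then have "int n dvd (int i + int j) - int (\<pi> i)" by (simp add: dvd_minus_mod)
        then show "int n dvd int j - (int (\<pi> i) - int i)" by (simp add: algebra_simps)
      qed
    qed simp
    moreover have "(\<Sum>i = 0..<n. int (\<pi> i) - int i) = 0"
      using sum.permute[OF \<pi>, of int] by (simp add: sum_subtractf o_def)
    ultimately show "supported_mod n 0 (signof \<pi> * (\<Prod>i = 0..<n. norm_mat p $$ (i, \<pi> i)))"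
      by (auto simp: sign_def supported_mod_def)
  qed
  then show "coeff (reduced_norm p) k \<noteq> 0 \<Longrightarrow> n dvd k"
    unfolding supported_mod_def by (simp add: int_dvd_int_iff)
qed

lemma reduced_norm_at_xn: "reduced_norm (at_xn H) = at_xn H ^ n"
proof -
  have "norm_mat (at_xn H) = at_xn H \<cdot>\<^sub>m 1\<^sub>m n"
  proof (rule eq_matI)
    fix i c assume "i < dim_row (at_xn H \<cdot>\<^sub>m 1\<^sub>m n)" "c < dim_col (at_xn H \<cdot>\<^sub>m 1\<^sub>m n)"
    then have ic: "i < n" "c < n" by auto
    have fixed: "(\<sigma> ^^ e) (\<iota> x) = \<iota> x" for e x by (induction e) auto
    have "(i + j) mod n = i" if "n dvd j" for j using that ic by auto
    then have "coeff (norm_mat (at_xn H) $$ (i, c)) j = (if i = c then coeff (at_xn H) j else 0)" for j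
      by (cases "n dvd j") (simp_all add: coeff_norm_mat[OF ic] coeff_at_xn fixed)
    then show "norm_mat (at_xn H) $$ (i, c) = (at_xn H \<cdot>\<^sub>m 1\<^sub>m n) $$ (i, c)"
      using ic by (simp add: poly_eq_iff)
  qed auto
  then show ?thesis by (simp add: reduced_norm_def)
qed

end

section \<open>Norms of the right divisors of F(x^n)\<close>

context central_factor
begin

text \<open>F is prime in K[y], so the norm of \<open>a\<close>, as a divisor of F^n there, is c
  F^j. As F is monic, c is the leading coefficient, and comparing the coefficients at both ends
  eliminates it. The degree clause matters also by itself, for a = f.\<close>

lemma right_divisor_norm:
  assumes monic: "lead_coeff F = 1" and a: "a rdvd at_xn F"
  obtains j where "degree a = degree F * j"
    "field_norm \<iota> (coeff a 0)
      = (- 1) ^ (degree a * (n - 1)) * coeff (at_xn F) 0 ^ j * field_norm \<iota> (lead_coeff a)"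
proof -
  obtain b where b: "at_xn F = b \<odot> a" using a unfolding skew_right_dvd_def by blast
  have "at_xn F \<noteq> 0" using F_nonzero by simp
  then have a0: "a \<noteq> 0" using b by auto
  obtain Ha where Ha: "reduced_norm a = at_xn Ha"
    using in_range_at_xn[of "reduced_norm a"] reduced_norm_supported reduced_norm_fixed by blast
  obtain Hb where Hb: "reduced_norm b = at_xn Hb"
    using in_range_at_xn[of "reduced_norm b"] reduced_norm_supported reduced_norm_fixed by blast
  have "at_xn (F ^ n) = at_xn (Hb * Ha)"
    using reduced_norm_mult[of b a] reduced_norm_at_xn[of F]
    by (simp add: at_xn_power at_xn_mult Ha Hb flip: b)
  then have "Ha dvd F ^ n" by (simp add: at_xn_eq_iff)
  then obtain u j where "is_unit u" and Haj: "Ha = u * F ^ j"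
    using divisor_of_prime_power field_poly_irreducible_imp_prime[OF F_irreducible] by blast
  then obtain c where u: "u = [:c:]" "c \<noteq> 0" unfolding is_unit_poly_iff by force
  have "n * degree Ha = degree a * n"
    using degree_reduced_norm[OF a0] by (simp add: Ha degree_at_xn)
  then have "degree Ha = degree a" using n_pos by simp
  moreover have "degree Ha = degree F * j"
    using u by (simp add: Haj degree_power_eq F_nonzero mult.commute)
  ultimately have deg: "degree a = degree F * j" by simp
  have "lead_coeff Ha = c"
    using monic u by (simp add: Haj lead_coeff_power)
  then have "\<iota> c = coeff (reduced_norm a) (degree a * n)"
    using \<open>degree Ha = degree a\<close> n_pos by (simp add: Ha coeff_at_xn)
  also have "\<dots> = field_norm \<iota> (lead_coeff a) * (- 1) ^ (degree a * (n - 1))"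
    by (simp only: reduced_norm_top(2) power_mult[symmetric] mult.commute[of "n - 1"])
  finally have lead: "\<iota> c = field_norm \<iota> (lead_coeff a) * (- 1) ^ (degree a * (n - 1))" .
  have "field_norm \<iota> (coeff a 0) = coeff (at_xn (u * F ^ j)) 0"
    using coeff_0_reduced_norm[of a] by (simp add: Ha Haj)
  also have "\<dots> = \<iota> c * coeff (at_xn F) 0 ^ j"
    by (simp add: at_xn_mult at_xn_power coeff_mult_0 coeff_0_power) (simp add: u coeff_at_xn)
  finally show thesis using that[OF deg] lead by (simp add: mult_ac)
qed

end

theorem mainTheorem3:
  fixes \<iota> :: "'k::field \<Rightarrow> 'l::field"
    and \<sigma> :: "'l \<Rightarrow> 'l"
    and F :: "'k poly"
    and f a :: "'l poly"
    and n s m l k :: nat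
  assumes "2 \<le> n"
    and "cyclic_galois_extension \<iota> n \<sigma>"
    and "lead_coeff F = 1"
    and "irreducible F"
    and "degree F = s"
    and "F \<noteq> [:0, 1:]"
    and "has_irreducible_factors \<sigma> (at_x_power \<iota> n F) m"
    and "l = n div m"
    and "skew_irreducible \<sigma> f"
    and "skew_right_dvd \<sigma> f (at_x_power \<iota> n F)"
    and "degree a < s * n"
    and "a \<noteq> 0"
    and "degree a \<le> s * k * l"
    and "k \<le> m"
  shows "m - k \<le> skew_rank \<sigma> f a \<and>
    (skew_rank \<sigma> f a = m - k \<longrightarrow>
       degree a = s * k * l \<and>
       field_norm \<iota> (coeff a 0) / field_norm \<iota> (coeff a (s * k * l))
         = (- 1) ^ (s * k * l * (n - 1)) * coeff (at_x_power \<iota> n F) 0 ^ (k * l))"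
proof -
  \<comment> \<open>If the constant coefficient were 0, then F = y G with G constant by
    irreducibility, and F being monic would be y, which is excluded.\<close>
  have F0: "coeff F 0 \<noteq> 0"
  proof
    assume "coeff F 0 = 0"
    then obtain G where G: "F = pCons 0 G" by (cases F) auto
    then have FG: "F = [:0, 1:] * G" by simp
    have "\<not> is_unit [:0, 1 :: 'k:]" by (simp add: is_unit_poly_iff)
    then have "is_unit G" using irreducibleD[OF assms(4) FG] by blast
    then obtain c where "G = [:c:]" unfolding is_unit_poly_iff by blast
    then show False using G assms(3,6) by (auto split: if_splits)
  qed
  interpret central_factor \<iota> n \<sigma> F
    using assms(2,4) F0 by unfold_locales
  have irr: "skew_irreducible \<sigma> f" and f: "f rdvd at_xn F" using assms by blast+
  have df: "0 < degree f" using skew_irreducible_degree[OF irr] by blast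
  have mf: "m * degree f = n * s" using factors_degree[OF irr f assms(7)] assms(5) by simp
  \<comment> \<open>The norm of \<open>f\<close> itself shows that s divides deg f; with m deg f = n
    s this gives m j = n, so that \<open>n div m\<close> is exact.\<close>
  obtain j where j: "degree f = s * j"
    using right_divisor_norm[OF assms(3) f] assms(5) by metis
  then have s: "0 < s" using df by simp
  have "m * j = n" using mf j s by (simp add: mult.left_commute)
  then have "l = j" and ml: "m * l = n" using assms(8) n_pos by auto
  then have fl: "degree f = s * l" using j by simp
  define r where "r = skew_rank \<sigma> f a"
  have ns: "n * degree F = m * (s * l)" using ml assms(5) by (simp add: mult_ac)
  have bound: "m * (s * l) \<le> r * (s * l) + degree a"
    using rank_bound(1)[OF irr f assms(12)] unfolding ns fl r_def .
  also have "\<dots> \<le> (r + k) * (s * l)" using assms(13) by (simp add: algebra_simps)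
  finally have "m \<le> r + k" using df fl by simp
  moreover have "degree a = s * k * l \<and>
      field_norm \<iota> (coeff a 0) / field_norm \<iota> (coeff a (s * k * l))
        = (- 1) ^ (s * k * l * (n - 1)) * coeff (at_xn F) 0 ^ (k * l)" if r: "r = m - k"
  proof -
    have split: "m * (s * l) = r * (s * l) + k * (s * l)"
      using r assms(14) by (simp flip: add_mult_distrib)
    have deg: "degree a = s * k * l" using bound split assms(13) by (simp add: mult_ac)
    then have "skew_rank \<sigma> f a * degree f + degree a = n * degree F"
      unfolding ns fl using split by (simp add: r_def mult_ac)
    then have "a rdvd at_xn F" by (rule rank_bound(2)[OF irr f assms(12)])
    then obtain i where i: "degree a = degree F * i" and norm: "field_norm \<iota> (coeff a 0)
        = (- 1) ^ (degree a * (n - 1)) * coeff (at_xn F) 0 ^ i * field_norm \<iota> (lead_coeff a)"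
      using right_divisor_norm[OF assms(3)] by metis
    have "i = k * l" using i s deg assms(5) by (simp add: mult.assoc)
    \<comment> \<open>Division by zero yields 0 in HOL, so passing from the product formula to the
      quotient requires this.\<close>
    moreover have "field_norm \<iota> (lead_coeff a) \<noteq> 0"
      using assms(12) by (simp add: field_norm_eq_0_iff)
    ultimately show ?thesis using norm deg by simp
  qed
  ultimately show ?thesis unfolding r_def by auto
qed

end
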